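(* Given $u_0\in L^1(\Omega)$, there exists a unique solution $u\in C([0,\infty);L^1(\Omega))$ of the local/nonlocal Dirichlet problem such that $u(\cdot,0)=u_0$. Moreover, a comparison principle holds: if $u_0,v_0\in L^1(\Omega)$ satisfy $u_0\ge v_0$, then the corresponding solutions $u,v$ satisfy $u\ge v$ in $\Omega\times\mathbb{R}_+$.
   Context: Let $N\ge 1$, let $J:\mathbb{R}^N\to\mathbb{R}$ be a nonnegative radial function with $\int_{\mathbb{R}^N}J=1$, and let $\alpha>0$ be a fixed constant. Let $\Omega\subset\mathbb{R}^N$ be a bounded smooth domain divided by a smooth hypersurface $\Gamma$ into two subsets $\Omega_\ell$ (local region) and $\Omega_{n\ell}$ (nonlocal region). For $x\in\Gamma$, $\eta(x)$ is the unit normal to $\Gamma$ pointing towards $\Omega_{n\ell}$, and $\partial_\eta u$ is the derivative in the direction $\eta$ taken from the side of $\Omega_\ell$. The local/nonlocal Dirichlet problem is $$u_t(x,t)=\Delta u(x,t)+\alpha\int_{\mathbb{R}^N\setminus\Omega_\ell}J(x-y)(u(y,t)-u(x,t))\,dy,\quad x\in\Omega_\ell,\ t>0,\qquad \partial_\eta u(x,t)=0,\quad x\in\Gamma,\ t>0,$$ $$u_t(x,t)=\alpha\int_{\mathbb{R}^N\setminus\Omega_{n\ell}}J(x-y)(u(y,t)-u(x,t))\,dy+2\alpha\int_{\Omega_{n\ell}}J(x-y)(u(y,t)-u(x,t))\,dy,\quad x\in\Omega_{n\ell},\ t>0,$$ $$u(x,t)=0,\quad x\in\mathbb{R}^N\setminus\Omega,\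 t>0,$$ with initial condition $u(\cdot,0)=u_0$ in $\Omega$. Functions on $\Omega$ are extended by zero outside $\Omega$, and hence also on $\partial\Omega$ (in particular $u=0$ on $\partial\Omega\cap\partial\Omega_\ell$). Solutions are understood in the mild sense: on $\Omega_{n\ell}$ the equation holds integrated in time from $0$ to $t$, and on $\Omega_\ell$ one has $u(t)=S(t)u_0+\int_0^tS(t-s)F(s)\,ds$, where $S$ is the heat semigroup on $\Omega_\ell$ with homogeneous Neumann condition on $\Gamma$ and zero Dirichlet condition on $\partial\Omega\cap\partial\Omega_\ell$, and $F(x,s)=\alpha\int_{\mathbb{R}^N\setminus\Omega_\ell}J(x-y)(u(y,s)-u(x,s))\,dy$. *)

theory Defs
  imports "HOL-Analysis.Analysis"
begin

section \<open>The Banach space of Lebesgue integrable functions\<close>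

text \<open>Integrable functions on the whole space modulo equality almost everywhere.\<close>

quotient_type (overloaded) 'a L1 = "'a::euclidean_space \<Rightarrow> real" / partial:
  "\<lambda>f g. integrable lebesgue f \<and> integrable lebesgue g \<and> (AE x in lebesgue. f x = g x)"
proof (rule part_equivpI)
  show "\<exists>f :: 'a \<Rightarrow> real. integrable lebesgue f \<and> integrable lebesgue f \<and> (AE x in lebesgue. f x = f x)"
    by (rule exI[of _ "\<lambda>_. 0"]) simp
  show "symp (\<lambda>(f :: 'a \<Rightarrow> real) g. integrable lebesgue f \<and> integrable lebesgue g \<and>
      (AE x in lebesgue. f x = g x))"
    by (auto intro!: sympI)
  show "transp (\<lambda>(f :: 'a \<Rightarrow> real) g. integrable lebesgue f \<and> integrable lebesgue g \<and>
      (AE x in lebesgue. f x = g x))"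
    by (auto intro!: transpI)
qed

instantiation L1 :: (euclidean_space) real_normed_vector
begin

lift_definition zero_L1 :: "'a L1" is "\<lambda>_. 0" by simp
lift_definition plus_L1 :: "'a L1 \<Rightarrow> 'a L1 \<Rightarrow> 'a L1" is "\<lambda>f g x. f x + g x" by auto
lift_definition minus_L1 :: "'a L1 \<Rightarrow> 'a L1 \<Rightarrow> 'a L1" is "\<lambda>f g x. f x - g x" by auto
lift_definition uminus_L1 :: "'a L1 \<Rightarrow> 'a L1" is "\<lambda>f x. - f x" by auto
lift_definition scaleR_L1 :: "real \<Rightarrow> 'a L1 \<Rightarrow> 'a L1" is "\<lambda>c f x. c * f x" by auto
lift_definition norm_L1 :: "'a L1 \<Rightarrow> real" is "\<lambda>f. LINT x|lebesgue. \<bar>f x\<bar>"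
  by (auto intro!: integral_cong_AE)

definition dist_L1 :: "'a L1 \<Rightarrow> 'a L1 \<Rightarrow> real" where "dist_L1 u v = norm (u - v)"
definition sgn_L1 :: "'a L1 \<Rightarrow> 'a L1" where "sgn_L1 u = inverse (norm u) *\<^sub>R u"
definition uniformity_L1 :: "('a L1 \<times> 'a L1) filter"
  where "uniformity_L1 = (INF e\<in>{0<..}. principal {(u, v). dist u v < e})"
definition open_L1 :: "'a L1 set \<Rightarrow> bool"
  where "open_L1 U \<longleftrightarrow> (\<forall>u\<in>U. \<forall>\<^sub>F (u', v) in uniformity. u' = u \<longrightarrow> v \<in> U)"

instance
proof
  fix a b :: real and u v w :: "'a L1" and U :: "'a L1 set"
  show "u + v + w = u + (v + w)" by transfer (auto simp: algebra_simps)
  show "u + v = v + u" by transfer (auto simp: algebra_simps)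
  show "0 + u = u" by transfer auto
  show "- u + u = 0" by transfer auto
  show "u - v = u + - v" by transfer auto
  show "a *\<^sub>R (u + v) = a *\<^sub>R u + a *\<^sub>R v" by transfer (auto simp: algebra_simps)
  show "(a + b) *\<^sub>R u = a *\<^sub>R u + b *\<^sub>R u" by transfer (auto simp: algebra_simps)
  show "a *\<^sub>R b *\<^sub>R u = (a * b) *\<^sub>R u" by transfer (auto simp: algebra_simps)
  show "1 *\<^sub>R u = u" by transfer auto
  show "norm u = 0 \<longleftrightarrow> u = 0"
    by transfer (auto simp: integral_nonneg_eq_0_iff_AE)
  show "norm (u + v) \<le> norm u + norm v"
  proof transfer
    fix f g :: "'a \<Rightarrow> real"
    assume "integrable lebesgue f \<and> integrable lebesgue f \<and> (AE x in lebesgue. f x = f x)"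
      and "integrable lebesgue g \<and> integrable lebesgue g \<and> (AE x in lebesgue. g x = g x)"
    then have f: "integrable lebesgue f" and g: "integrable lebesgue g" by auto
    have "(LINT x|lebesgue. \<bar>f x + g x\<bar>) \<le> (LINT x|lebesgue. \<bar>f x\<bar> + \<bar>g x\<bar>)"
      by (rule integral_mono) (use f g in auto)
    also have "\<dots> = (LINT x|lebesgue. \<bar>f x\<bar>) + (LINT x|lebesgue. \<bar>g x\<bar>)"
      by (rule Bochner_Integration.integral_add) (use f g in auto)
    finally show "(LINT x|lebesgue. \<bar>f x + g x\<bar>) \<le>
      (LINT x|lebesgue. \<bar>f x\<bar>) + (LINT x|lebesgue. \<bar>g x\<bar>)" .
  qed
  show "norm (a *\<^sub>R u) = \<bar>a\<bar> * norm u" by transfer (simp add: abs_mult)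
  show "dist u v = norm (u - v)" by (simp add: dist_L1_def)
  show "sgn u = inverse (norm u) *\<^sub>R u" by (simp add: sgn_L1_def)
  show "uniformity = (INF e\<in>{0<..}. principal {(u, v :: 'a L1). dist u v < e})"
    by (simp add: uniformity_L1_def)
  show "open U \<longleftrightarrow> (\<forall>u\<in>U. \<forall>\<^sub>F (u', v) in uniformity. u' = u \<longrightarrow> v \<in> U)"
    by (simp add: open_L1_def)
qed

end

text \<open>\<^term>\<open>rep_L1 u\<close> is some representative of the class \<^term>\<open>u\<close>. The space of integrable functions
  on a set is realised, through extension by zero, as a subspace of \<^typ>\<open>'a L1\<close>.\<close>

definition L1_on :: "'a::euclidean_space set \<Rightarrow> 'a L1 set"
  where "L1_on A = {u. AE x in lebesgue. x \<notin> A \<longrightarrow> rep_L1 u x = 0}"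

text \<open>Restriction to \<^term>\<open>A\<close>, extended by zero again (for measurable \<^term>\<open>A\<close>).\<close>

definition restrict_L1 :: "'a::euclidean_space set \<Rightarrow> 'a L1 \<Rightarrow> 'a L1"
  where "restrict_L1 A u = abs_L1 (\<lambda>x. indicator A x * rep_L1 u x)"


section \<open>Geometry\<close>

text \<open>Functions of class \<open>C\<^sup>k\<close> on an open set.\<close>

primrec Ck_on :: "nat \<Rightarrow> 'a::euclidean_space set \<Rightarrow> ('a \<Rightarrow> real) \<Rightarrow> bool" where
  "Ck_on 0 U f \<longleftrightarrow> continuous_on U f"
| "Ck_on (Suc k) U f \<longleftrightarrow>
     f differentiable_on U \<and> (\<forall>b\<in>Basis. Ck_on k U (\<lambda>x. frechet_derivative f (at x) b))"

text \<open>Smooth functions on \<^term>\<open>U\<close> without critical points. The level sets of such functions are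
  the smooth hypersurfaces in \<^term>\<open>U\<close>.\<close>

definition smooth_submersion :: "'a::euclidean_space set \<Rightarrow> ('a \<Rightarrow> real) \<Rightarrow> bool"
  where "smooth_submersion U r \<longleftrightarrow> open U \<and> (\<forall>k. Ck_on k U r) \<and>
    (\<forall>x\<in>U. frechet_derivative r (at x) \<noteq> (\<lambda>_. 0))"

definition smooth_bounded_domain :: "'a::euclidean_space set \<Rightarrow> bool"
  where "smooth_bounded_domain \<Omega> \<longleftrightarrow> open \<Omega> \<and> connected \<Omega> \<and> \<Omega> \<noteq> {} \<and> bounded \<Omega> \<and>
    (\<forall>x\<in>frontier \<Omega>. \<exists>U r. x \<in> U \<and> smooth_submersion U r \<and> \<Omega> \<inter> U = {y\<in>U. r y < 0})"

text \<open>The smooth hypersurface \<^term>\<open>\<Gamma>\<close> divides \<^term>\<open>\<Omega>\<close> into \<^term>\<open>\<Omega>\<^sub>l\<close> and \<^term>\<open>\<Omega>\<^sub>n\<close>. The gradient of a local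
  defining function points from \<^term>\<open>\<Omega>\<^sub>l\<close> towards \<^term>\<open>\<Omega>\<^sub>n\<close>, as the unit normal does. Nothing is
  required of \<^term>\<open>\<Gamma>\<close> at points of the boundary of \<^term>\<open>\<Omega>\<close>, which it may or may not reach.\<close>

definition divides_domain ::
  "'a::euclidean_space set \<Rightarrow> 'a set \<Rightarrow> 'a set \<Rightarrow> 'a set \<Rightarrow> bool"
  where "divides_domain \<Gamma> \<Omega> \<Omega>\<^sub>l \<Omega>\<^sub>n \<longleftrightarrow>
    \<Omega> = \<Omega>\<^sub>l \<union> \<Gamma> \<union> \<Omega>\<^sub>n \<and> \<Omega>\<^sub>l \<inter> \<Omega>\<^sub>n = {} \<and> \<Omega>\<^sub>l \<inter> \<Gamma> = {} \<and> \<Omega>\<^sub>n \<inter> \<Gamma> = {} \<and>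
    open \<Omega>\<^sub>l \<and> open \<Omega>\<^sub>n \<and> \<Omega>\<^sub>l \<noteq> {} \<and> \<Omega>\<^sub>n \<noteq> {} \<and>
    (\<forall>x\<in>\<Gamma>. \<exists>U r. x \<in> U \<and> U \<subseteq> \<Omega> \<and> smooth_submersion U r \<and>
       \<Gamma> \<inter> U = {y\<in>U. r y = 0} \<and> \<Omega>\<^sub>l \<inter> U = {y\<in>U. r y < 0} \<and> \<Omega>\<^sub>n \<inter> U = {y\<in>U. r y > 0})"


section \<open>The heat semigroup with mixed boundary conditions\<close>

definition L2_fun :: "'a::euclidean_space set \<Rightarrow> ('a \<Rightarrow> 'b::euclidean_space) \<Rightarrow> bool"
  where "L2_fun U f \<longleftrightarrow> f \<in> borel_measurable (lebesgue_on U) \<and>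
    integrable (lebesgue_on U) (\<lambda>x. (norm (f x))\<^sup>2)"

definition L2_tendsto ::
  "'a::euclidean_space set \<Rightarrow> ('i \<Rightarrow> 'a \<Rightarrow> 'b::euclidean_space) \<Rightarrow> ('a \<Rightarrow> 'b) \<Rightarrow> 'i filter \<Rightarrow> bool"
  where "L2_tendsto U F f K \<longleftrightarrow>
    ((\<lambda>i. LINT x|lebesgue_on U. (norm (F i x - f x))\<^sup>2) \<longlongrightarrow> 0) K"

text \<open>\<open>C\<^sup>1\<close> functions in \<open>H\<^sup>1(U)\<close> that vanish in a neighbourhood of \<^term>\<open>D\<close>, with their gradients.\<close>

definition test_pair ::
  "'a::euclidean_space set \<Rightarrow> 'a set \<Rightarrow> ('a \<Rightarrow> real) \<Rightarrow> ('a \<Rightarrow> 'a) \<Rightarrow> bool"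
  where "test_pair U D \<phi> \<psi> \<longleftrightarrow>
    (\<forall>x\<in>U. GDERIV \<phi> x :> \<psi> x) \<and> continuous_on U \<psi> \<and> L2_fun U \<phi> \<and> L2_fun U \<psi> \<and>
    (\<exists>W. open W \<and> D \<subseteq> W \<and> (\<forall>x\<in>U \<inter> W. \<phi> x = 0))"

text \<open>Membership of \<^term>\<open>u\<close> in \<open>H\<^sup>1\<^sub>D(U)\<close>, the functions in \<open>H\<^sup>1(U)\<close> with zero boundary values on
  \<^term>\<open>D\<close>, with weak gradient \<^term>\<open>g\<close>: the closure of the test functions in \<open>H\<^sup>1(U)\<close>. For empty
  \<^term>\<open>D\<close> this is \<open>H\<^sup>1(U)\<close> by the Meyers-Serrin theorem.\<close>

definition H1D :: "'a::euclidean_space set \<Rightarrow> 'a set \<Rightarrow> ('a \<Rightarrow> real) \<Rightarrow> ('a \<Rightarrow> 'a) \<Rightarrow> bool"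
  where "H1D U D u g \<longleftrightarrow> L2_fun U u \<and> L2_fun U g \<and>
    (\<exists>\<phi> \<psi>. (\<forall>n::nat. test_pair U D (\<phi> n) (\<psi> n)) \<and>
       L2_tendsto U \<phi> u sequentially \<and> L2_tendsto U \<psi> g sequentially)"

text \<open>\<^term>\<open>u\<close> is in the domain of the Laplacian on \<open>L\<^sup>2(U)\<close> with zero Dirichlet condition on
  \<^term>\<open>D\<close> and zero Neumann condition on the rest of the boundary of \<^term>\<open>U\<close>, and \<^term>\<open>w\<close> is its
  Laplacian. The Neumann condition is the natural boundary condition of the Dirichlet form: by
  Green's formula, the normal derivative vanishes since test functions are free off \<^term>\<open>D\<close>.\<close>

definition mixed_laplacian ::
  "'a::euclidean_space set \<Rightarrow> 'a set \<Rightarrow> ('a \<Rightarrow> real) \<Rightarrow> ('a \<Rightarrow> real) \<Rightarrow> bool"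
  where "mixed_laplacian U D u w \<longleftrightarrow> L2_fun U w \<and>
    (\<exists>g. H1D U D u g \<and> (\<forall>\<phi> \<psi>. H1D U D \<phi> \<psi> \<longrightarrow>
       (LINT x|lebesgue_on U. g x \<bullet> \<psi> x) = - (LINT x|lebesgue_on U. w x * \<phi> x)))"

definition C0_semigroup :: "'b::real_normed_vector set \<Rightarrow> (real \<Rightarrow> 'b \<Rightarrow> 'b) \<Rightarrow> bool"
  where "C0_semigroup X S \<longleftrightarrow>
    (\<forall>t\<ge>0. S t ` X \<subseteq> X \<and>
       (\<forall>f\<in>X. \<forall>g\<in>X. S t (f + g) = S t f + S t g) \<and>
       (\<forall>f\<in>X. \<forall>c. S t (c *\<^sub>R f) = c *\<^sub>R S t f) \<and>
       (\<exists>C. \<forall>f\<in>X. norm (S t f) \<le> C * norm f)) \<and>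
    (\<forall>f\<in>X. S 0 f = f) \<and>
    (\<forall>s\<ge>0. \<forall>t\<ge>0. \<forall>f\<in>X. S (s + t) f = S s (S t f)) \<and>
    (\<forall>f\<in>X. continuous_on {0..} (\<lambda>t. S t f))"

text \<open>\<^term>\<open>S\<close> is the heat semigroup on \<open>L\<^sup>1(U)\<close>: for square integrable \<^term>\<open>f\<close>, the orbit
  \<open>t \<mapsto> S t f\<close> is the solution in \<open>L\<^sup>2(U)\<close> of the heat equation with the mixed boundary conditions
  and initial value \<^term>\<open>f\<close>. Since such solutions are unique and the square integrable functions
  are dense in \<open>L\<^sup>1(U)\<close>, this determines \<^term>\<open>S\<close> on \<open>L\<^sup>1(U)\<close>. Values of \<^term>\<open>S\<close> outside of
  \<^term>\<open>L1_on U\<close>, or at negative times, are irrelevant.\<close>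

definition heat_semigroup ::
  "'a::euclidean_space set \<Rightarrow> 'a set \<Rightarrow> (real \<Rightarrow> 'a L1 \<Rightarrow> 'a L1) \<Rightarrow> bool"
  where "heat_semigroup U D S \<longleftrightarrow> C0_semigroup (L1_on U) S \<and>
    (\<forall>f\<in>L1_on U. L2_fun U (rep_L1 f) \<longrightarrow>
       (\<forall>t\<ge>0. L2_fun U (rep_L1 (S t f))) \<and>
       L2_tendsto U (\<lambda>t. rep_L1 (S t f)) (rep_L1 f) (at_right 0) \<and>
       (\<forall>t>0. \<exists>w. mixed_laplacian U D (rep_L1 (S t f)) w \<and>
          L2_tendsto U (\<lambda>h x. (rep_L1 (S (t + h) f) x - rep_L1 (S t f) x) / h) w (at 0)))"


section \<open>The local/nonlocal Dirichlet problem\<close>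

definition radial :: "('a::real_normed_vector \<Rightarrow> real) \<Rightarrow> bool"
  where "radial J \<longleftrightarrow> (\<forall>x y. norm x = norm y \<longrightarrow> J x = J y)"

definition nonlocal_term :: "('a::euclidean_space \<Rightarrow> real) \<Rightarrow> 'a set \<Rightarrow> ('a \<Rightarrow> real) \<Rightarrow> 'a \<Rightarrow> real"
  where "nonlocal_term J A u x = (LINT y:A|lebesgue. J (x - y) * (u y - u x))"

text \<open>The nonlocal parts of the right-hand sides in \<^term>\<open>\<Omega>\<^sub>l\<close> and \<^term>\<open>\<Omega>\<^sub>n\<close>, as classes of functions
  extended by zero. The integrals converge for almost every \<^term>\<open>x\<close>.\<close>

definition local_region_source ::
  "('a::euclidean_space \<Rightarrow> real) \<Rightarrow> real \<Rightarrow> 'a set \<Rightarrow> 'a L1 \<Rightarrow> 'a L1"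
  where "local_region_source J \<alpha> \<Omega>\<^sub>l u =
    abs_L1 (\<lambda>x. indicator \<Omega>\<^sub>l x * (\<alpha> * nonlocal_term J (- \<Omega>\<^sub>l) (rep_L1 u) x))"

definition nonlocal_region_rhs ::
  "('a::euclidean_space \<Rightarrow> real) \<Rightarrow> real \<Rightarrow> 'a set \<Rightarrow> 'a L1 \<Rightarrow> 'a L1"
  where "nonlocal_region_rhs J \<alpha> \<Omega>\<^sub>n u =
    abs_L1 (\<lambda>x. indicator \<Omega>\<^sub>n x *
      (\<alpha> * nonlocal_term J (- \<Omega>\<^sub>n) (rep_L1 u) x + 2 * \<alpha> * nonlocal_term J \<Omega>\<^sub>n (rep_L1 u) x))"

text \<open>Mild solutions in \<open>C([0,\<infinity>); L\<^sup>1(\<Omega>))\<close>; only the values \<open>u t\<close> for \<open>t \<ge> 0\<close> matter. Membership in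
  \<^term>\<open>L1_on \<Omega>\<close> is the exterior condition. Time integrals are integrals of functions with values in
  \<^typ>\<open>'a L1\<close>.\<close>

definition mild_solution ::
  "('a::euclidean_space \<Rightarrow> real) \<Rightarrow> real \<Rightarrow> 'a set \<Rightarrow> 'a set \<Rightarrow> 'a set \<Rightarrow>
   (real \<Rightarrow> 'a L1 \<Rightarrow> 'a L1) \<Rightarrow> 'a L1 \<Rightarrow> (real \<Rightarrow> 'a L1) \<Rightarrow> bool"
  where "mild_solution J \<alpha> \<Omega> \<Omega>\<^sub>l \<Omega>\<^sub>n S u0 u \<longleftrightarrow>
    continuous_on {0..} u \<and> (\<forall>t\<ge>0. u t \<in> L1_on \<Omega>) \<and> u 0 = u0 \<and>
    (\<forall>t\<ge>0. ((\<lambda>s. nonlocal_region_rhs J \<alpha> \<Omega>\<^sub>n (u s)) has_integral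
       (restrict_L1 \<Omega>\<^sub>n (u t) - restrict_L1 \<Omega>\<^sub>n u0)) {0..t}) \<and>
    (\<forall>t\<ge>0. ((\<lambda>s. S (t - s) (local_region_source J \<alpha> \<Omega>\<^sub>l (u s))) has_integral
       (restrict_L1 \<Omega>\<^sub>l (u t) - S t (restrict_L1 \<Omega>\<^sub>l u0))) {0..t})"

end

theory Submission
  imports Defs
begin

text \<open>The heat flow on \<open>\<Omega>\<^sub>l\<close>, together with the identity off \<open>\<Omega>\<^sub>l\<close>, is a contraction semigroup \<open>T\<close>
  on \<open>L\<^sup>1\<close>, and the nonlocal terms form a bounded operator \<open>B\<close>. Since \<open>\<Gamma>\<close> is a null set, mild solutions
  are the solutions of \<open>u(t) = T(t) u\<^sub>0 + \<integral>\<^sub>0\<^sup>t T(t - s) B u(s) ds\<close>, which exist by Banach's fixed point theorem.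
  For comparison, let \<open>N f\<close> be the integral of the negative part of \<open>f\<close>. Energy estimates with smooth convex
  approximations of the negative part, and the density of \<open>L\<^sup>2\<close>, show that \<open>T\<close> decreases \<open>N\<close>, which
  also yields contractivity. The operator \<open>B + c\<close> is positive for large \<open>c\<close>, and \<open>exp (c t) u(t)\<close> solves the
  equation with \<open>B + c\<close> in place of \<open>B\<close>, so Gronwall's inequality shows that \<open>N u\<close> stays zero if it
  vanishes initially. Uniqueness is comparison in both directions.\<close>

section \<open>The space of integrable functions\<close>

text \<open>The heat flow is known only variationally: orbits of square integrable data solve the
  equation in L2, the boundary conditions are encoded in the closure of a class of test functions,
  and the bounds in \<open>C0_semigroup\<close> may depend on the time. There is no heat kernel and
  no pointwise maximum principle to start from, so all of the analysis has to come from one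
  inequality that survives the passage from L2 to L1. The integral of the negative part serves
  because it is convex, positively homogeneous and continuous on L1, and because it controls sign
  and size together: \<open>norm f\<close> is \<open>N f + N (- f)\<close>.

  The obstacle to positivity of \<open>B\<close> is its loss part, minus \<open>u x\<close> times a
  mass of the kernel. These masses are at most 1, so a fixed multiple of the identity absorbs them.

  A single equation for \<open>T\<close> suffices because the coupled system is its pair of
  restrictions: on the nonlocal region \<open>T\<close> is the identity, so the variation of
  constants formula reduces there to the equation integrated in time.\<close>

lemma rep_abs_L1:
  fixes f :: "'a::euclidean_space \<Rightarrow> real"
  assumes "integrable lebesgue f"
  shows "AE x in lebesgue. rep_L1 (abs_L1 f) x = f x"
  using Quotient3_rep_abs[OF Quotient3_L1, of f] assms by auto

lemma integrable_rep_L1 [simp]: "integrable lebesgue (rep_L1 u)"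
  using Quotient3_rep_reflp[OF Quotient3_L1, of u] by auto

lemma rep_L1_measurable [measurable]: "rep_L1 u \<in> borel_measurable lebesgue"
  using integrable_rep_L1 by (rule borel_measurable_integrable)

lemma abs_rep_L1 [simp]: "abs_L1 (rep_L1 u) = u"
  using Quotient3_abs_rep[OF Quotient3_L1] .

lemma abs_L1_eqI:
  assumes "integrable lebesgue f" "integrable lebesgue g" "AE x in lebesgue. f x = g x"
  shows "abs_L1 f = abs_L1 g"
  using Quotient3_rel_abs[OF Quotient3_L1, of f g] assms by auto

lemma L1_eqI: "AE x in lebesgue. rep_L1 u x = rep_L1 v x \<Longrightarrow> u = v"
  using abs_L1_eqI[of "rep_L1 u" "rep_L1 v"] by simp

lemma abs_L1_plus:
  assumes "integrable lebesgue f" "integrable lebesgue g"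
  shows "abs_L1 f + abs_L1 g = abs_L1 (\<lambda>x. f x + g x)"
  using plus_L1.abs_eq[of f g] assms by simp

lemma abs_L1_scaleR:
  assumes "integrable lebesgue f"
  shows "c *\<^sub>R abs_L1 f = abs_L1 (\<lambda>x. c * f x)"
  using scaleR_L1.abs_eq[of f c] assms by simp

lemma rep_plus_L1: "AE x in lebesgue. rep_L1 (u + v) x = rep_L1 u x + rep_L1 v x"
  using rep_abs_L1[of "\<lambda>x. rep_L1 u x + rep_L1 v x"] abs_L1_plus[of "rep_L1 u" "rep_L1 v"] by simp

lemma rep_minus_L1: "AE x in lebesgue. rep_L1 (u - v) x = rep_L1 u x - rep_L1 v x"
  using rep_abs_L1[of "\<lambda>x. rep_L1 u x - rep_L1 v x"] minus_L1.abs_eq[of "rep_L1 u" "rep_L1 v"] by simp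

lemma rep_scaleR_L1: "AE x in lebesgue. rep_L1 (c *\<^sub>R u) x = c * rep_L1 u x"
  using rep_abs_L1[of "\<lambda>x. c * rep_L1 u x"] abs_L1_scaleR[of "rep_L1 u" c] by simp

lemma rep_zero_L1: "AE x in lebesgue. rep_L1 0 x = 0"
  using rep_abs_L1[of "\<lambda>x. 0"] unfolding zero_L1.abs_eq by simp

lemma norm_L1_eq: "norm u = (LINT x|lebesgue. \<bar>rep_L1 u x\<bar>)"
  using norm_L1.abs_eq[of "rep_L1 u"] by simp

lemma norm_abs_L1:
  "integrable lebesgue f \<Longrightarrow> norm (abs_L1 f) = (LINT x|lebesgue. \<bar>f x\<bar>)"
  using norm_L1.abs_eq[of f] by simp

lemma dist_L1_eq: "dist u v = (LINT x|lebesgue. \<bar>rep_L1 u x - rep_L1 v x\<bar>)"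
proof -
  have "u - v = abs_L1 (\<lambda>x. rep_L1 u x - rep_L1 v x)"
    using minus_L1.abs_eq[of "rep_L1 u" "rep_L1 v"] by simp
  then show ?thesis
    unfolding dist_norm by (simp add: norm_abs_L1)
qed

text \<open>Riesz-Fischer: a fast Cauchy subsequence telescopes into an absolutely convergent series.\<close>

instance L1 :: (euclidean_space) banach
proof
  fix X :: "nat \<Rightarrow> 'a L1"
  assume X: "Cauchy X"
  have "\<exists>N. \<forall>m\<ge>N. \<forall>n\<ge>N. dist (X m) (X n) < (1/2)^k" for k :: nat
    using X unfolding Cauchy_def by (metis zero_less_divide_1_iff zero_less_numeral zero_less_power)
  then obtain N where N: "\<And>k m n. m \<ge> N k \<Longrightarrow> n \<ge> N k \<Longrightarrow> dist (X m) (X n) < (1/2)^k" by metis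
  \<comment> \<open>Taking the maximum with \<open>N (Suc k)\<close> in the recursion makes the
    indices strictly increasing and late enough at once, so that consecutive terms are
    \<open>(1/2)^k\<close>-close.\<close>
  define r where "r = rec_nat (N 0) (\<lambda>k m. Suc (max m (N (Suc k))))"
  have r: "strict_mono r" by (rule strict_monoI_Suc) (simp add: r_def less_Suc_eq_le)
  have rN: "r k \<ge> N k" for k by (cases k) (auto simp: r_def)
  have d: "dist (X (r (Suc k))) (X (r k)) < (1/2)^k" for k
    using N[OF _ rN] rN r by (metis le_trans lessI less_imp_le strict_mono_less_eq)
  define f where "f k x = rep_L1 (X (r (Suc k))) x - rep_L1 (X (r k)) x" for k x
  have f [simp]: "integrable lebesgue (f k)" for k unfolding f_def by auto
  have nf: "(LINT x|lebesgue. norm (f k x)) < (1/2)^k" for k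
    using d[of k] by (simp add: f_def dist_L1_eq)
  have sum_norm: "summable (\<lambda>k. LINT x|lebesgue. norm (f k x))"
    by (rule summable_comparison_test'[of "\<lambda>k. (1/2)^k"])
       (use nf in \<open>auto intro!: less_imp_le simp: summable_geometric\<close>)
  have "(\<integral>\<^sup>+x. (\<Sum>k. ennreal (norm (f k x))) \<partial>lebesgue)
      = (\<Sum>k. \<integral>\<^sup>+x. ennreal (norm (f k x)) \<partial>lebesgue)"
    by (rule nn_integral_suminf) (use f in measurable)
  also have "\<dots> = (\<Sum>k. ennreal (LINT x|lebesgue. norm (f k x)))"
    by (subst nn_integral_eq_integral) auto
  also have "\<dots> < \<infinity>" using sum_norm by (simp add: suminf_ennreal2 less_top)
  finally have "(\<integral>\<^sup>+x. (\<Sum>k. ennreal (norm (f k x))) \<partial>lebesgue) \<noteq> \<infinity>" by simp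
  then have "AE x in lebesgue. (\<Sum>k. ennreal (norm (f k x))) \<noteq> \<infinity>"
    by (intro nn_integral_PInf_AE) (use f in measurable)
  then have ae: "AE x in lebesgue. summable (\<lambda>k. norm (f k x))"
    by eventually_elim (auto intro: summable_suminf_not_top)
  have int_norm: "integrable lebesgue (\<lambda>x. \<Sum>k. norm (f k x))"
    by (rule integrable_suminf) (use ae sum_norm in auto)
  have int_f: "integrable lebesgue (\<lambda>x. \<Sum>k. f k x)"
    by (rule integrable_suminf) (use ae sum_norm in auto)
  define L where "L = (\<lambda>x. rep_L1 (X (r 0)) x + (\<Sum>k. f k x))"
  have L: "integrable lebesgue L" unfolding L_def using int_f by auto
  have tele: "rep_L1 (X (r n)) x = rep_L1 (X (r 0)) x + (\<Sum>k<n. f k x)" for n x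
    unfolding f_def by (subst sum_lessThan_telescope) simp
  have rL: "rep_L1 (X (r n)) x - L x = (\<Sum>k<n. f k x) - (\<Sum>k. f k x)" for n x
    using tele[of n x] by (simp add: L_def)
  \<comment> \<open>The dominating function is twice the sum of the absolute values: one copy for
    the partial sum, one for the limit.\<close>
  have "(\<lambda>n. LINT x|lebesgue. \<bar>rep_L1 (X (r n)) x - L x\<bar>) \<longlonglongrightarrow> (LINT x|(lebesgue :: 'a measure). 0)"
  proof (rule integral_dominated_convergence[where w="\<lambda>x. 2 * (\<Sum>k. norm (f k x))"])
    show "AE x in lebesgue. (\<lambda>n. \<bar>rep_L1 (X (r n)) x - L x\<bar>) \<longlonglongrightarrow> 0"
      using ae
    proof eventually_elim
      case (elim x)
      have "(\<lambda>n. (\<Sum>k<n. f k x)) \<longlonglongrightarrow> (\<Sum>k. f k x)"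
        using summable_LIMSEQ[OF summable_norm_cancel[OF elim]] .
      then have "(\<lambda>n. \<bar>(\<Sum>k<n. f k x) - (\<Sum>k. f k x)\<bar>) \<longlonglongrightarrow> 0"
        by (metis LIM_zero tendsto_rabs_zero)
      then show ?case by (simp add: rL)
    qed
    show "AE x in lebesgue. norm \<bar>rep_L1 (X (r n)) x - L x\<bar> \<le> 2 * (\<Sum>k. norm (f k x))" for n
      using ae
    proof eventually_elim
      case (elim x)
      have "\<bar>\<Sum>k<n. f k x\<bar> \<le> (\<Sum>k<n. norm (f k x))" by simp
      also have "\<dots> \<le> (\<Sum>k. norm (f k x))" by (rule sum_le_suminf[OF elim]) auto
      finally have "\<bar>\<Sum>k<n. f k x\<bar> \<le> (\<Sum>k. norm (f k x))" .
      moreover have "\<bar>\<Sum>k. f k x\<bar> \<le> (\<Sum>k. norm (f k x))"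
        using summable_norm[OF elim] by simp
      ultimately show ?case unfolding rL by simp
    qed
  qed (use L int_norm in auto)
  moreover have "dist (X (r n)) (abs_L1 L) = (LINT x|lebesgue. \<bar>rep_L1 (X (r n)) x - L x\<bar>)" for n
    unfolding dist_L1_eq
    by (rule integral_cong_AE) (use L rep_abs_L1[OF L] in auto)
  ultimately have "(X \<circ> r) \<longlonglongrightarrow> abs_L1 L"
    by (subst tendsto_dist_iff) (simp add: o_def)
  then show "convergent X"
    using Cauchy_converges_subseq[OF X r] by (auto simp: convergent_def)
qed

subsection \<open>Integral and negative part\<close>

definition int_L1 :: "'a::euclidean_space L1 \<Rightarrow> real"
  where "int_L1 u = (LINT x|lebesgue. rep_L1 u x)"

lemma bounded_linear_int_L1: "bounded_linear int_L1"
proof (rule bounded_linear_intro[of _ 1])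
  fix u v :: "'a L1" and c :: real
  have "int_L1 (u + v) = (LINT x|lebesgue. rep_L1 u x + rep_L1 v x)"
    unfolding int_L1_def by (rule integral_cong_AE) (use rep_plus_L1[of u v] in auto)
  then show "int_L1 (u + v) = int_L1 u + int_L1 v"
    unfolding int_L1_def by simp
  have "int_L1 (c *\<^sub>R u) = (LINT x|lebesgue. c * rep_L1 u x)"
    unfolding int_L1_def by (rule integral_cong_AE) (use rep_scaleR_L1[of c u] in auto)
  then show "int_L1 (c *\<^sub>R u) = c *\<^sub>R int_L1 u"
    unfolding int_L1_def by simp
  show "norm (int_L1 u) \<le> norm u * 1"
    unfolding int_L1_def norm_L1_eq using integral_norm_bound[of lebesgue "rep_L1 u"] by simp
qed

text \<open>The integral of the negative part. Being expressed by the norm and a linear functional, it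
  passes under integrals of \<^typ>\<open>'a L1\<close>-valued functions.\<close>

definition neg_L1 :: "'a::euclidean_space L1 \<Rightarrow> real"
  where "neg_L1 u = (norm u - int_L1 u) / 2"

lemma neg_L1_eq: "neg_L1 u = (LINT x|lebesgue. max 0 (- rep_L1 u x))"
proof -
  have "(LINT x|lebesgue. max 0 (- rep_L1 u x)) = (LINT x|lebesgue. (\<bar>rep_L1 u x\<bar> - rep_L1 u x) / 2)"
    by (rule Bochner_Integration.integral_cong) auto
  also have "\<dots> = ((LINT x|lebesgue. \<bar>rep_L1 u x\<bar>) - (LINT x|lebesgue. rep_L1 u x)) / 2"
    by simp
  finally show ?thesis by (simp add: neg_L1_def norm_L1_eq int_L1_def)
qed

lemma neg_L1_nonneg: "neg_L1 u \<ge> 0"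
  unfolding neg_L1_eq by (rule Bochner_Integration.integral_nonneg) auto

lemma neg_L1_eq_0_iff: "neg_L1 u = 0 \<longleftrightarrow> (AE x in lebesgue. rep_L1 u x \<ge> 0)"
  unfolding neg_L1_eq
  by (subst integral_nonneg_eq_0_iff_AE) (auto intro!: AE_cong)

lemmas int_L1_add = linear_add[OF bounded_linear.linear[OF bounded_linear_int_L1]]
  and int_L1_minus = linear_neg[OF bounded_linear.linear[OF bounded_linear_int_L1]]
  and int_L1_scaleR = linear_scale[OF bounded_linear.linear[OF bounded_linear_int_L1]]

lemma neg_L1_add_le: "neg_L1 (u + v) \<le> neg_L1 u + neg_L1 v"
  unfolding neg_L1_def using norm_triangle_ineq[of u v] by (simp add: int_L1_add field_simps)

lemma neg_L1_scaleR: "c \<ge> 0 \<Longrightarrow> neg_L1 (c *\<^sub>R u) = c * neg_L1 u"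
  unfolding neg_L1_def by (simp add: int_L1_scaleR algebra_simps)

text \<open>This turns a one-sided estimate, applied to a function and to its negative, into a norm
  estimate. Contractivity of the flow, boundedness of the nonlocal operators and uniqueness are all
  obtained this way.\<close>

lemma norm_eq_neg_L1: "norm u = neg_L1 u + neg_L1 (- u)"
  unfolding neg_L1_def by (simp add: int_L1_minus field_simps)

lemma continuous_on_neg_L1 [continuous_intros]:
  "continuous_on X f \<Longrightarrow> continuous_on X (\<lambda>x. neg_L1 (f x))"
  unfolding neg_L1_def divide_inverse
  by (intro continuous_intros bounded_linear.continuous_on[OF bounded_linear_int_L1])

lemma neg_L1_integral_le:
  fixes f :: "real \<Rightarrow> 'a::euclidean_space L1"
  assumes f: "continuous_on {a..b} f"
  shows "neg_L1 (integral {a..b} f) \<le> integral {a..b} (\<lambda>s. neg_L1 (f s))"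
proof -
  have if': "f integrable_on {a..b}" using f by (rule integrable_continuous_interval)
  have nf: "(\<lambda>s. norm (f s)) integrable_on {a..b}"
    by (intro integrable_continuous_interval continuous_intros f)
  have inf: "(\<lambda>s. int_L1 (f s)) integrable_on {a..b}"
    by (intro integrable_continuous_interval f
        bounded_linear.continuous_on[OF bounded_linear_int_L1])
  have "norm (integral {a..b} f) \<le> integral {a..b} (\<lambda>s. norm (f s))"
    by (rule integral_norm_bound_integral[OF if' nf]) simp
  moreover have "int_L1 (integral {a..b} f) = integral {a..b} (\<lambda>s. int_L1 (f s))"
    using integral_linear[OF if' bounded_linear_int_L1] by (simp add: o_def)
  ultimately show ?thesis
    unfolding neg_L1_def by (simp add: integral_diff[OF nf inf])
qed

subsection \<open>Restriction to subsets\<close>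

lemma integrable_indicator_rep_L1:
  assumes "A \<in> sets lebesgue"
  shows "integrable lebesgue (\<lambda>x. indicator A x * rep_L1 u x)"
  using integrable_mult_indicator[OF assms integrable_rep_L1[of u]] by simp

lemma rep_restrict_L1:
  assumes "A \<in> sets lebesgue"
  shows "AE x in lebesgue. rep_L1 (restrict_L1 A u) x = indicator A x * rep_L1 u x"
  unfolding restrict_L1_def by (rule rep_abs_L1[OF integrable_indicator_rep_L1[OF assms]])

lemma bounded_linear_restrict_L1:
  assumes A: "A \<in> sets lebesgue"
  shows "bounded_linear (restrict_L1 A)"
proof (rule bounded_linear_intro[of _ 1])
  fix u v :: "'a L1" and c :: real
  show "restrict_L1 A (u + v) = restrict_L1 A u + restrict_L1 A v"
    by (rule L1_eqI)
      (use rep_restrict_L1[OF A, of u] rep_restrict_L1[OF A, of v] rep_restrict_L1[OF A, of "u + v"]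
        rep_plus_L1[of u v] rep_plus_L1[of "restrict_L1 A u" "restrict_L1 A v"]
        in eventually_elim, simp add: algebra_simps)
  show "restrict_L1 A (c *\<^sub>R u) = c *\<^sub>R restrict_L1 A u"
    by (rule L1_eqI)
      (use rep_restrict_L1[OF A, of u] rep_restrict_L1[OF A, of "c *\<^sub>R u"]
        rep_scaleR_L1[of c u] rep_scaleR_L1[of c "restrict_L1 A u"]
        in eventually_elim, simp add: algebra_simps)
  show "norm (restrict_L1 A u) \<le> norm u * 1"
    unfolding restrict_L1_def norm_abs_L1[OF integrable_indicator_rep_L1[OF A]] norm_L1_eq[of u]
    by simp (rule integral_mono, use integrable_indicator_rep_L1[OF A, of u] in
      \<open>auto simp: indicator_def\<close>)
qed

text \<open>Supports are thereby described as fixed spaces of bounded projections, so closure under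
  sums and under vector-valued integrals follows from linearity instead of pointwise
  arguments.\<close>

lemma in_L1_on_iff:
  assumes A: "A \<in> sets lebesgue"
  shows "u \<in> L1_on A \<longleftrightarrow> restrict_L1 A u = u"
proof
  assume "u \<in> L1_on A"
  then have "AE x in lebesgue. x \<notin> A \<longrightarrow> rep_L1 u x = 0" by (simp add: L1_on_def)
  with rep_restrict_L1[OF A, of u]
  have "AE x in lebesgue. rep_L1 (restrict_L1 A u) x = rep_L1 u x"
    by eventually_elim (auto simp: indicator_def)
  then show "restrict_L1 A u = u" by (rule L1_eqI)
next
  assume "restrict_L1 A u = u"
  then show "u \<in> L1_on A"
    using rep_restrict_L1[OF A, of u] by (auto simp: L1_on_def elim!: eventually_mono)
qed

lemma restrict_restrict_L1:
  assumes A: "A \<in> sets lebesgue" and B: "B \<in> sets lebesgue"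
  shows "restrict_L1 A (restrict_L1 B u) = restrict_L1 (A \<inter> B) u"
  by (rule L1_eqI)
    (use rep_restrict_L1[OF A, of "restrict_L1 B u"] rep_restrict_L1[OF B, of u]
      rep_restrict_L1[of "A \<inter> B" u] A B in \<open>auto elim!: eventually_elim2 simp: indicator_def\<close>)

lemma restrict_L1_empty: "restrict_L1 {} u = 0"
  by (rule L1_eqI)
    (use rep_restrict_L1[of "{}" u] rep_zero_L1 in \<open>auto elim!: eventually_elim2\<close>)

text \<open>The two pieces live on disjoint sets, so almost everywhere at most one of them is
  nonzero. Subadditivity alone would not do: the extended flow moves one piece, and the bounds for
  both must add up to the original value.\<close>

lemma neg_restrict_L1_add:
  assumes A: "A \<in> sets lebesgue"
  shows "neg_L1 (restrict_L1 A u) + neg_L1 (u - restrict_L1 A u) = neg_L1 u"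
proof -
  let ?v = "restrict_L1 A u"
  have "neg_L1 ?v + neg_L1 (u - ?v)
      = (LINT x|lebesgue. max 0 (- rep_L1 ?v x) + max 0 (- rep_L1 (u - ?v) x))"
    unfolding neg_L1_eq by simp
  also have "\<dots> = (LINT x|lebesgue. max 0 (- rep_L1 u x))"
  proof (rule integral_cong_AE)
    show "AE x in lebesgue. max 0 (- rep_L1 ?v x) + max 0 (- rep_L1 (u - ?v) x) = max 0 (- rep_L1 u x)"
      using rep_restrict_L1[OF A, of u] rep_minus_L1[of u ?v]
      by eventually_elim (auto simp: indicator_def)
  qed auto
  finally show ?thesis by (simp add: neg_L1_eq)
qed

section \<open>Bounded perturbations of contraction semigroups\<close>

text \<open>The primitive \<open>A\<close> of \<open>a\<close>, multiplied by
  \<open>exp (- K s)\<close>, has nonpositive derivative and vanishes at 0. Since \<open>A\<close>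
  is also nonnegative, it is zero, and the hypothesis at time \<open>t\<close> finishes.\<close>

lemma gronwall_zero:
  fixes a :: "real \<Rightarrow> real"
  assumes cont: "continuous_on {0..} a"
    and nonneg: "\<And>t. t \<ge> 0 \<Longrightarrow> a t \<ge> 0"
    and le: "\<And>t. t \<ge> 0 \<Longrightarrow> a t \<le> K * integral {0..t} a"
    and "t \<ge> 0"
  shows "a t = 0"
proof (rule antisym)
  define A where "A s = integral {0..s} a" for s
  define P where "P s = exp (- K * s) * A s" for s
  have ct: "continuous_on {0..t} a"
    by (rule continuous_on_subset[OF cont]) auto
  have dA: "(A has_real_derivative a s) (at s within {0..t})" if "s \<in> {0..t}" for s
    unfolding A_def has_real_derivative_iff_has_vector_derivative
    using integral_has_vector_derivative[OF ct that] .
  have dP: "(P has_real_derivative exp (- K * s) * (a s - K * A s)) (at s within {0..t})"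
    if "s \<in> {0..t}" for s
    unfolding P_def by (rule derivative_eq_intros dA[OF that] refl)+ (simp add: algebra_simps)
  have "P t \<le> P 0"
  proof (rule DERIV_nonpos_imp_decreasing_open[OF \<open>t \<ge> 0\<close>])
    show "\<exists>y. (P has_real_derivative y) (at x) \<and> y \<le> 0" if "0 < x" "x < t" for x
    proof (intro exI conjI)
      show "(P has_real_derivative exp (- K * x) * (a x - K * A x)) (at x)"
        using dP[of x] that at_within_Icc_at[of 0 x t] by simp
      show "exp (- K * x) * (a x - K * A x) \<le> 0"
        using le[of x] that by (simp add: A_def mult_nonneg_nonpos)
    qed
    show "continuous_on {0..t} P"
      using dP by (metis DERIV_continuous continuous_on_eq_continuous_within)
  qed
  then have "A t \<le> 0" by (simp add: P_def A_def mult_le_0_iff)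
  moreover have "A t \<ge> 0" unfolding A_def
    by (rule Henstock_Kurzweil_Integration.integral_nonneg)
      (use ct nonneg in \<open>auto intro: integrable_continuous_interval\<close>)
  ultimately show "a t \<le> 0" using le[OF \<open>t \<ge> 0\<close>] by (simp add: A_def)
qed (rule nonneg[OF \<open>t \<ge> 0\<close>])

text \<open>In Duhamel's integral the time occurs both as a limit of integration and in the
  integrand. On a fixed interval its continuity is that of an integral depending on a
  parameter.\<close>

lemma integral_rescale_unit:
  fixes g :: "real \<Rightarrow> 'b::banach"
  assumes g: "continuous_on {0..t} g" and t: "t \<ge> 0"
  shows "integral {0..t} g = t *\<^sub>R integral {0..1} (\<lambda>\<sigma>. g (t * \<sigma>))"
proof (cases "t = 0")
  case False
  then have t: "t > 0" using t by simp
  have "(g has_integral integral {0..t} g) (cbox 0 t)"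
    using integrable_continuous_interval[OF g] by (simp add: integrable_integral)
  from has_integral_affinity[OF this, of t 0] t
  have "((\<lambda>\<sigma>. g (t * \<sigma>)) has_integral (1 / t) *\<^sub>R integral {0..t} g) {0..1}"
    by (simp add: image_mult_atLeastAtMost)
  then have "integral {0..1} (\<lambda>\<sigma>. g (t * \<sigma>)) = (1 / t) *\<^sub>R integral {0..t} g"
    by (rule integral_unique)
  then show ?thesis using t by simp
qed simp

locale contraction_semigroup =
  fixes T :: "real \<Rightarrow> 'b::banach \<Rightarrow> 'b"
  assumes linear: "\<And>t. t \<ge> 0 \<Longrightarrow> linear (T t)"
    and contraction: "\<And>t f. t \<ge> 0 \<Longrightarrow> norm (T t f) \<le> norm f"
    and at_0: "\<And>f. T 0 f = f"
    and semigroup: "\<And>s t f. s \<ge> 0 \<Longrightarrow> t \<ge> 0 \<Longrightarrow> T (s + t) f = T s (T t f)"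
    and strongly_continuous: "\<And>f. continuous_on {0..} (\<lambda>t. T t f)"
begin

lemma bounded_linear: "t \<ge> 0 \<Longrightarrow> bounded_linear (T t)"
  using contraction
  by (intro bounded_linear_intro[of _ 1]) (auto simp: linear_add linear_scale linear)

text \<open>The increment splits into \<open>T (a y)\<close> applied to \<open>F y - F x\<close>,
  small because the operators are contractions uniformly in time, and the motion of the fixed vector
  \<open>F x\<close>, small by strong continuity.\<close>

lemma jointly_continuous:
  assumes a: "continuous_on X a" and F: "continuous_on X F" and nonneg: "\<And>x. x \<in> X \<Longrightarrow> a x \<ge> 0"
  shows "continuous_on X (\<lambda>x. T (a x) (F x))"
  unfolding continuous_on_def
proof
  fix x assume x: "x \<in> X"
  have "continuous_on X (\<lambda>y. T (a y) (F x))"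
    by (rule continuous_on_compose2[OF strongly_continuous a]) (use nonneg in auto)
  then have "((\<lambda>y. T (a y) (F x) - T (a x) (F x)) \<longlongrightarrow> 0) (at x within X)"
    using x by (simp add: continuous_on_def LIM_zero)
  moreover have "((\<lambda>y. F y - F x) \<longlongrightarrow> 0) (at x within X)"
    using x F by (simp add: continuous_on_def LIM_zero)
  ultimately have "((\<lambda>y. norm (F y - F x) + norm (T (a y) (F x) - T (a x) (F x))) \<longlongrightarrow> 0) (at x within X)"
    using tendsto_add[OF tendsto_norm_zero tendsto_norm_zero] by fastforce
  moreover have "norm (T (a y) (F y) - T (a x) (F x))
      \<le> norm (F y - F x) + norm (T (a y) (F x) - T (a x) (F x))" if "y \<in> X" for y
  proof -
    have "T (a y) (F y) - T (a x) (F x) = T (a y) (F y - F x) + (T (a y) (F x) - T (a x) (F x))"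
      using linear[OF nonneg[OF that]] by (simp add: linear_diff)
    then show ?thesis
      using norm_triangle_ineq contraction[OF nonneg[OF that], of "F y - F x"] by (smt (verit))
  qed
  ultimately have "((\<lambda>y. T (a y) (F y) - T (a x) (F x)) \<longlongrightarrow> 0) (at x within X)"
    by (elim Lim_null_comparison[rotated]) (auto simp: eventually_at_filter)
  then show "((\<lambda>y. T (a y) (F y)) \<longlongrightarrow> T (a x) (F x)) (at x within X)"
    by (rule LIM_zero_cancel)
qed

text \<open>Duhamel's formula for the generator of \<open>T\<close> perturbed by \<open>B\<close>.
  With \<open>has_integral\<close>, existence of the integral is part of the statement.\<close>

definition mild :: "('b \<Rightarrow> 'b) \<Rightarrow> 'b \<Rightarrow> (real \<Rightarrow> 'b) \<Rightarrow> bool"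
  where "mild B u0 u \<longleftrightarrow>
    (\<forall>t\<ge>0. ((\<lambda>s. T (t - s) (B (u s))) has_integral (u t - T t u0)) {0..t})"

lemma continuous_integrand:
  assumes "bounded_linear B" "continuous_on {0..} u"
  shows "continuous_on {0..t} (\<lambda>s. T (t - s) (B (u s)))"
  by (intro jointly_continuous bounded_linear.continuous_on[OF assms(1)] continuous_intros
      continuous_on_subset[OF assms(2)]) auto

text \<open>Integrating the derivative of \<open>s \<mapsto> exp (c s) T(t - s) u(s)\<close> over \<open>[0, t]\<close> avoids Fubini's theorem.\<close>

lemma mild_exp_shift:
  assumes B: "bounded_linear B" and u: "continuous_on {0..} u" and mild: "mild B u0 u"
  shows "mild (\<lambda>f. B f + c *\<^sub>R f) u0 (\<lambda>t. exp (c * t) *\<^sub>R u t)"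
  unfolding mild_def
proof (intro allI impI)
  fix t :: real assume t: "t \<ge> 0"
  define g where "g r = T (t - r) (B (u r))" for r
  define G where "G s = integral {0..s} g" for s
  have cg: "continuous_on {0..t} g"
    unfolding g_def by (rule continuous_integrand[OF B u])
  have dG: "(G has_vector_derivative g s) (at s within {0..t})" if "s \<in> {0..t}" for s
    unfolding G_def using integral_has_vector_derivative[OF cg that] .
  \<comment> \<open>Applying \<open>T (t - s)\<close> to the formula at time \<open>s\<close> moves
    all terms to the common final time \<open>t\<close>. The orbit thus becomes a constant plus a
    primitive of a continuous function, hence differentiable in \<open>s\<close>, although
    \<open>u\<close> itself need not be.\<close>
  have Tu: "T (t - s) (u s) = T t u0 + G s" if s: "s \<in> {0..t}" for s
  proof -
    have "((\<lambda>r. T (t - s) (T (s - r) (B (u r)))) has_integral T (t - s) (u s - T s u0)) {0..s}"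
      using has_integral_linear[OF mild[unfolded mild_def, rule_format] bounded_linear[of "t - s"], of s] s
      by (simp add: o_def)
    then have "(g has_integral T (t - s) (u s - T s u0)) {0..s}"
      by (rule has_integral_eq[rotated])
        (use semigroup[of "t - s"] s in \<open>auto simp: g_def simp flip: semigroup\<close>)
    then have "G s = T (t - s) (u s - T s u0)"
      unfolding G_def by (rule integral_unique)
    also have "\<dots> = T (t - s) (u s) - T t u0"
      using s semigroup[of "t - s" s u0] linear[of "t - s"] by (simp add: linear_diff)
    finally show ?thesis by simp
  qed
  define Q where "Q s = exp (c * s) *\<^sub>R (T t u0 + G s)" for s
  have "((\<lambda>s. exp (c * s) *\<^sub>R g s + (c * exp (c * s)) *\<^sub>R (T t u0 + G s)) has_integral Q t - Q 0) {0..t}"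
  proof (rule fundamental_theorem_of_calculus[OF t])
    fix s assume s: "s \<in> {0..t}"
    have "((\<lambda>s. exp (c * s)) has_real_derivative c * exp (c * s)) (at s within {0..t})"
      by (auto intro!: derivative_eq_intros)
    moreover have "((\<lambda>s. T t u0 + G s) has_vector_derivative g s) (at s within {0..t})"
      using dG[OF s] by (auto intro!: derivative_eq_intros)
    ultimately show "(Q has_vector_derivative
        exp (c * s) *\<^sub>R g s + (c * exp (c * s)) *\<^sub>R (T t u0 + G s)) (at s within {0..t})"
      unfolding Q_def by (rule has_vector_derivative_scaleR)
  qed
  moreover have "Q t = exp (c * t) *\<^sub>R u t" "Q 0 = T t u0"
    using Tu[of t] t by (simp_all add: Q_def at_0 G_def)
  ultimately have int: "((\<lambda>s. exp (c * s) *\<^sub>R g s + (c * exp (c * s)) *\<^sub>R (T t u0 + G s)) has_integral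
      exp (c * t) *\<^sub>R u t - T t u0) {0..t}" by simp
  show "((\<lambda>s. T (t - s) (B (exp (c * s) *\<^sub>R u s) + c *\<^sub>R exp (c * s) *\<^sub>R u s)) has_integral
      exp (c * t) *\<^sub>R u t - T t u0) {0..t}"
  proof (rule has_integral_eq[OF _ int])
    fix s assume s: "s \<in> {0..t}"
    then have "linear (T (t - s))" by (intro linear) simp
    then show "exp (c * s) *\<^sub>R g s + (c * exp (c * s)) *\<^sub>R (T t u0 + G s)
      = T (t - s) (B (exp (c * s) *\<^sub>R u s) + c *\<^sub>R exp (c * s) *\<^sub>R u s)"
      using linear_simps(5)[OF B]
      by (simp add: g_def linear_add linear_scale flip: Tu[OF s])
  qed
qed

lemma mild_diff:
  assumes "bounded_linear B" "mild B u0 u" "mild B v0 v"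
  shows "mild B (u0 - v0) (\<lambda>t. u t - v t)"
  unfolding mild_def
proof (intro allI impI)
  fix t :: real assume t: "t \<ge> 0"
  have "((\<lambda>s. T (t - s) (B (u s)) - T (t - s) (B (v s))) has_integral
      (u t - T t u0) - (v t - T t v0)) {0..t}"
    using assms t unfolding mild_def by (intro has_integral_diff) auto
  moreover have "(u t - T t u0) - (v t - T t v0) = u t - v t - T t (u0 - v0)"
    using linear[OF t] by (simp add: linear_diff)
  ultimately show "((\<lambda>s. T (t - s) (B (u s - v s))) has_integral u t - v t - T t (u0 - v0)) {0..t}"
    by (auto elim!: has_integral_eq[rotated] simp: linear linear_diff linear_simps(2)[OF assms(1)])
qed

text \<open>Banach's fixed point theorem for \<open>w(t) = exp (- m t) u(t)\<close> in the space of bounded continuous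
  functions, with \<open>m\<close> larger than the norm of the perturbation. Functions on the half line are
  extended to be constant on negative times.\<close>

theorem mild_exists:
  assumes B: "bounded_linear B"
  shows "\<exists>u. continuous_on {0..} u \<and> mild B u0 u"
proof -
  obtain K where K: "K > 0" "\<And>f. norm (B f) \<le> norm f * K"
    using bounded_linear.pos_bounded[OF B] by blast
  \<comment> \<open>The substitution of \<open>exp (m t) w(t)\<close> for \<open>u(t)\<close>
    produces the weight \<open>exp (m (s - t))\<close>, whose integral over \<open>[0,t]\<close> is
    at most \<open>1 / m\<close>. With \<open>m = 2 * K\<close> the factor \<open>K / m\<close> is
    the contraction constant 1/2.\<close>
  define m where "m = 2 * K"
  define I where "I w t = integral {0..t} (\<lambda>s. exp (m * (s - t)) *\<^sub>R T (t - s) (B (w s)))"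
    for w t
  have cont_integrand: "continuous_on {0..t} (\<lambda>s. exp (m * (s - t)) *\<^sub>R T (t - s) (B (w s)))"
    if "continuous_on {0..} w" for w t
    by (intro continuous_intros continuous_integrand[OF B that])
  have cont_I: "continuous_on {0..} (I w)" if w: "continuous_on {0..} w" for w
  proof -
    have "continuous_on {0..} (\<lambda>t. t *\<^sub>R integral (cbox 0 1)
        (\<lambda>\<sigma>. exp (m * (t * \<sigma> - t)) *\<^sub>R T (t - t * \<sigma>) (B (w (t * \<sigma>)))))"
    proof (intro continuous_on_scaleR continuous_on_id integral_continuous_on_param)
      have "continuous_on ({0..} \<times> cbox 0 1) (\<lambda>x. w (fst x * snd x))"
        by (rule continuous_on_compose2[OF w]) (auto intro!: continuous_intros)
      then have "continuous_on ({0..} \<times> cbox 0 1)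
          (\<lambda>x. T (fst x - fst x * snd x) (B (w (fst x * snd x))))"
        by (intro jointly_continuous bounded_linear.continuous_on[OF B] continuous_intros)
          (auto simp: mult_left_le)
      then show "continuous_on ({0..} \<times> cbox 0 1)
          (\<lambda>(t, \<sigma>). exp (m * (t * \<sigma> - t)) *\<^sub>R T (t - t * \<sigma>) (B (w (t * \<sigma>))))"
        unfolding split_beta by (intro continuous_intros)
    qed
    then show ?thesis
      by (rule continuous_on_eq) (simp add: I_def integral_rescale_unit[OF cont_integrand[OF w]])
  qed
  \<comment> \<open>Used twice: for a single function it keeps the iteration map inside the bounded
    functions, and for a difference of two it gives the contraction.\<close>
  have norm_I: "norm (I w t) \<le> b / 2"
    if w: "continuous_on {0..} w" and b: "\<And>s. s \<ge> 0 \<Longrightarrow> norm (w s) \<le> b" and t: "t \<ge> 0" for w b t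
  proof -
    have b0: "b \<ge> 0" using b[of 0] norm_ge_zero[of "w 0"] by linarith
    have "((\<lambda>s. exp (m * (s - t)) * (b * K)) has_integral
        exp (m * (t - t)) * (b * K) / m - exp (m * (0 - t)) * (b * K) / m) {0..t}"
      by (rule fundamental_theorem_of_calculus[OF t])
        (use K in \<open>auto intro!: derivative_eq_intros simp: m_def
          simp flip: has_real_derivative_iff_has_vector_derivative\<close>)
    note weight = this
    have "norm (I w t) \<le> integral {0..t} (\<lambda>s. exp (m * (s - t)) * (b * K))"
      unfolding I_def
    proof (rule integral_norm_bound_integral[OF
          integrable_continuous_interval[OF cont_integrand[OF w]] has_integral_integrable[OF weight]])
      fix s assume s: "s \<in> {0..t}"
      have "norm (T (t - s) (B (w s))) \<le> norm (B (w s))" using s by (intro contraction) auto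
      also have "\<dots> \<le> b * K" using K(2)[of "w s"] b[of s] s K(1)
        by (meson atLeastAtMost_iff less_imp_le mult_right_mono order_trans)
      finally show "norm (exp (m * (s - t)) *\<^sub>R T (t - s) (B (w s))) \<le> exp (m * (s - t)) * (b * K)"
        by simp
    qed
    also have "\<dots> \<le> b * K / m" unfolding integral_unique[OF weight] using K b0 by (simp add: m_def)
    also have "\<dots> = b / 2" using K by (simp add: m_def)
    finally show ?thesis .
  qed
  define \<Phi> where "\<Phi> w t = exp (- m * max t 0) *\<^sub>R T (max t 0) u0 + I w (max t 0)" for w t
  have \<Phi>_bcont: "\<Phi> (apply_bcontfun w) \<in> bcontfun" for w :: "real \<Rightarrow>\<^sub>C 'b"
  proof -
    have w: "continuous_on {0..} (apply_bcontfun w)" by simp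
    have "continuous_on UNIV (\<lambda>t. T (max t 0) u0)"
      by (intro jointly_continuous continuous_intros) auto
    moreover have "continuous_on UNIV (\<lambda>t. I w (max t 0))"
      by (rule continuous_on_compose2[OF cont_I[OF w]]) (auto intro!: continuous_intros)
    ultimately have "continuous_on UNIV (\<Phi> w)"
      unfolding \<Phi>_def by (intro continuous_intros)
    moreover have "norm (\<Phi> w t) \<le> norm u0 + norm w / 2" for t
    proof -
      have "norm (exp (- m * max t 0) *\<^sub>R T (max t 0) u0) \<le> 1 * norm u0"
        unfolding norm_scaleR using K by (intro mult_mono contraction) (auto simp: m_def)
      moreover have "norm (I w (max t 0)) \<le> norm w / 2"
        by (rule norm_I[OF w norm_bounded]) auto
      ultimately show ?thesis unfolding \<Phi>_def by (smt (verit) norm_triangle_ineq)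
    qed
    ultimately show ?thesis by (auto simp: bcontfun_def bounded_iff)
  qed
  have "\<exists>!w. Bcontfun (\<Phi> (apply_bcontfun w)) = w"
  proof (rule banach_fix_type[of "1/2"])
    show "\<forall>v w. dist (Bcontfun (\<Phi> (apply_bcontfun v))) (Bcontfun (\<Phi> (apply_bcontfun w))) \<le> 1/2 * dist v w"
    proof (intro allI dist_bound)
      fix v w :: "real \<Rightarrow>\<^sub>C 'b" and t :: real
      have c: "continuous_on {0..} (apply_bcontfun v)" "continuous_on {0..} (apply_bcontfun w)"
        by simp_all
      have "I v (max t 0) - I w (max t 0) = I (\<lambda>s. v s - w s) (max t 0)"
        unfolding I_def
          integral_diff[OF cont_integrand[OF c(1), THEN integrable_continuous_interval]
            cont_integrand[OF c(2), THEN integrable_continuous_interval], symmetric]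
        by (rule integral_cong)
          (simp add: linear linear_diff linear_simps(2)[OF B] scaleR_diff_right)
      moreover have "norm (I (\<lambda>s. v s - w s) (max t 0)) \<le> dist v w / 2"
        by (rule norm_I) (use c in \<open>auto intro!: continuous_intros simp: dist_bounded simp flip: dist_norm\<close>)
      ultimately show "dist (Bcontfun (\<Phi> (apply_bcontfun v)) t) (Bcontfun (\<Phi> (apply_bcontfun w)) t)
          \<le> 1/2 * dist v w"
        by (simp add: Bcontfun_inverse \<Phi>_bcont \<Phi>_def dist_norm[of "I v _"])
    qed
  qed auto
  then obtain w where "Bcontfun (\<Phi> (apply_bcontfun w)) = w" by blast
  then have fix_w: "\<Phi> w t = w t" for t
    using Bcontfun_inverse[OF \<Phi>_bcont[of w]] by metis
  define u where "u t = exp (m * t) *\<^sub>R w t" for t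
  have cw: "continuous_on {0..} (apply_bcontfun w)" by simp
  then have cu: "continuous_on {0..} u" unfolding u_def by (intro continuous_intros)
  have "mild B u0 u"
    unfolding mild_def
  proof (intro allI impI)
    fix t :: real assume t: "t \<ge> 0"
    have "((\<lambda>s. exp (m * (s - t)) *\<^sub>R T (t - s) (B (w s))) has_integral I w t) {0..t}"
      unfolding I_def using integrable_continuous_interval[OF cont_integrand[OF cw]]
      by (rule integrable_integral)
    from has_integral_cmul[OF this, of "exp (m * t)"]
    have "((\<lambda>s. exp (m * s) *\<^sub>R T (t - s) (B (w s))) has_integral exp (m * t) *\<^sub>R I w t) {0..t}"
      by (simp add: algebra_simps flip: exp_add)
    then have "((\<lambda>s. T (t - s) (B (u s))) has_integral exp (m * t) *\<^sub>R I w t) {0..t}"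
      by (rule has_integral_eq[rotated])
        (auto simp: u_def linear_simps(5)[OF B] linear linear_scale)
    moreover have "exp (m * t) *\<^sub>R I w t = u t - T t u0"
      using fix_w[of t] t
      by (simp add: u_def \<Phi>_def scaleR_add_right flip: fix_w exp_add)
    ultimately show "((\<lambda>s. T (t - s) (B (u s))) has_integral u t - T t u0) {0..t}" by simp
  qed
  with cu show ?thesis by blast
qed

end

text \<open>The hypothesis \<open>shift\<close> is positivity in quantitative form:
  \<open>B + c\<close> preserves nonnegative functions and enlarges negative parts by at most the
  factor \<open>K\<close>. In the formula for \<open>v\<close> the initial term has no negative
  part, so what remains is a homogeneous Gronwall inequality.\<close>

lemma mild_nonneg:
  fixes T :: "real \<Rightarrow> 'a::euclidean_space L1 \<Rightarrow> 'a L1"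
  assumes T: "contraction_semigroup T" and pos: "\<And>t f. t \<ge> 0 \<Longrightarrow> neg_L1 (T t f) \<le> neg_L1 f"
    and B: "bounded_linear B" and shift: "\<And>f. neg_L1 (B f + c *\<^sub>R f) \<le> K * neg_L1 f"
    and u: "continuous_on {0..} u" "contraction_semigroup.mild T B u0 u"
    and u0: "neg_L1 u0 = 0" and t: "t \<ge> 0"
  shows "neg_L1 (u t) = 0"
proof -
  interpret contraction_semigroup T by fact
  define A where "A f = B f + c *\<^sub>R f" for f
  have A: "bounded_linear A"
    unfolding A_def by (intro bounded_linear_add B bounded_linear_scaleR_right)
  define v where "v t = exp (c * t) *\<^sub>R u t" for t
  have v: "continuous_on {0..} v" unfolding v_def by (intro continuous_intros u)
  have mild: "mild A u0 v" unfolding A_def v_def by (rule mild_exp_shift[OF B u])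
  have "neg_L1 (v t) = 0"
  proof (rule gronwall_zero[OF _ _ _ t])
    show "continuous_on {0..} (\<lambda>t. neg_L1 (v t))" by (intro continuous_intros v)
    show "neg_L1 (v t) \<le> K * integral {0..t} (\<lambda>s. neg_L1 (v s))" if t: "t \<ge> 0" for t
    proof -
      have c: "continuous_on {0..t} (\<lambda>s. T (t - s) (A (v s)))" by (rule continuous_integrand[OF A v])
      have cv: "continuous_on {0..t} v" by (rule continuous_on_subset[OF v]) auto
      have "v t = T t u0 + integral {0..t} (\<lambda>s. T (t - s) (A (v s)))"
        using integral_unique[OF mild[unfolded mild_def, rule_format, OF t]] by simp
      then have "neg_L1 (v t) \<le> neg_L1 (T t u0) + neg_L1 (integral {0..t} (\<lambda>s. T (t - s) (A (v s))))"
        by (simp add: neg_L1_add_le)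
      also have "\<dots> \<le> 0 + integral {0..t} (\<lambda>s. neg_L1 (T (t - s) (A (v s))))"
        using pos[OF t, of u0] u0 by (intro add_mono neg_L1_integral_le c) simp
      also have "\<dots> \<le> 0 + integral {0..t} (\<lambda>s. K * neg_L1 (v s))"
      proof (intro add_mono order_refl integral_le integrable_continuous_interval continuous_intros c cv)
        fix s assume "s \<in> {0..t}"
        then have "neg_L1 (T (t - s) (A (v s))) \<le> neg_L1 (A (v s))" by (intro pos) simp
        also have "\<dots> \<le> K * neg_L1 (v s)" unfolding A_def by (rule shift)
        finally show "neg_L1 (T (t - s) (A (v s))) \<le> K * neg_L1 (v s)" .
      qed
      finally show ?thesis by simp
    qed
  qed (simp add: neg_L1_nonneg)
  then show ?thesis by (simp add: v_def neg_L1_scaleR)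
qed

section \<open>Hypersurfaces are null sets\<close>

lemma smooth_submersionD:
  assumes "smooth_submersion U r" "x \<in> U"
  shows "(r has_derivative frechet_derivative r (at x)) (at x)"
    and "\<exists>b\<in>Basis. frechet_derivative r (at x) b \<noteq> 0"
proof -
  have U: "open U" and C1: "Ck_on 1 U r"
    and nz: "frechet_derivative r (at x) \<noteq> (\<lambda>_. 0)"
    using assms unfolding smooth_submersion_def by auto
  from C1 have "r differentiable_on U" by simp
  then have "r differentiable (at x)"
    using U \<open>x \<in> U\<close> by (simp add: differentiable_on_eq_differentiable_at)
  then show d: "(r has_derivative frechet_derivative r (at x)) (at x)"
    by (simp add: frechet_derivative_works)
  show "\<exists>b\<in>Basis. frechet_derivative r (at x) b \<noteq> 0"
  proof (rule ccontr)
    assume "\<not> ?thesis"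
    then have "frechet_derivative r (at x) y = 0" for y
      using has_derivative_linear[OF d] linear_eq_0_on_span[of _ Basis y] by auto
    with nz show False by auto
  qed
qed

text \<open>Where the partial derivative in direction \<open>b\<close> does not vanish, replacing the \<open>b\<close>-coordinate
  by \<open>r\<close> has injective derivative and maps the zero set of \<open>r\<close> into a hyperplane.\<close>

lemma negligible_zero_set_submersion:
  fixes r :: "'a::euclidean_space \<Rightarrow> real"
  assumes r: "smooth_submersion U r"
  shows "negligible {y \<in> U. r y = 0}"
proof -
  let ?D = "\<lambda>x. frechet_derivative r (at x)"
  have "negligible {x \<in> {x \<in> U. ?D x b \<noteq> 0}. x + (r x - x \<bullet> b) *\<^sub>R b \<in> {y. b \<bullet> y = 0}}"
    if b: "b \<in> Basis" for b
  proof (rule negligible_differentiable_vimage[where f' = "\<lambda>x h. h + (?D x h - h \<bullet> b) *\<^sub>R b"])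
    show "negligible {y. b \<bullet> y = 0}"
      by (rule negligible_hyperplane) (use b in auto)
    fix x assume x: "x \<in> {x \<in> U. ?D x b \<noteq> 0}"
    then have d: "(r has_derivative ?D x) (at x)" using smooth_submersionD[OF r] by auto
    then have lin: "linear (?D x)" by (rule has_derivative_linear)
    show "((\<lambda>x. x + (r x - x \<bullet> b) *\<^sub>R b) has_derivative (\<lambda>h. h + (?D x h - h \<bullet> b) *\<^sub>R b))
        (at x within {x \<in> U. ?D x b \<noteq> 0})"
      by (rule has_derivative_at_withinI) (auto intro!: derivative_eq_intros d)
    show "inj (\<lambda>h. h + (?D x h - h \<bullet> b) *\<^sub>R b)"
    proof (subst linear_injective_0)
      show "Real_Vector_Spaces.linear (\<lambda>h. h + (?D x h - h \<bullet> b) *\<^sub>R b)"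
        by (rule linearI) (auto simp: linear_add[OF lin] linear_scale[OF lin] algebra_simps)
      \<comment> \<open>The inner product with \<open>b\<close> shows that \<open>h\<close> is in
        the kernel of the derivative of \<open>r\<close>. Then \<open>h\<close> is parallel to
        \<open>b\<close>, along which this derivative is nonzero.\<close>
      have "h = 0" if h: "h + (?D x h - h \<bullet> b) *\<^sub>R b = 0" for h
      proof -
        have "(h + (?D x h - h \<bullet> b) *\<^sub>R b) \<bullet> b = 0" using h by simp
        then have D: "?D x h = 0" using b by (simp add: inner_add_left)
        with h have "h = (h \<bullet> b) *\<^sub>R b" by simp
        then have "?D x h = (h \<bullet> b) * ?D x b" using linear_scale[OF lin, of "h \<bullet> b" b] by simp
        then have "h \<bullet> b = 0" using D x by simp
        with \<open>h = (h \<bullet> b) *\<^sub>R b\<close> show "h = 0" by simp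
      qed
      then show "\<forall>h. h + (?D x h - h \<bullet> b) *\<^sub>R b = 0 \<longrightarrow> h = 0" by blast
    qed
  qed
  then have "negligible (\<Union>b\<in>Basis. {x \<in> {x \<in> U. ?D x b \<noteq> 0}. x + (r x - x \<bullet> b) *\<^sub>R b \<in> {y. b \<bullet> y = 0}})"
    by (intro negligible_Union) auto
  moreover have "{y \<in> U. r y = 0} \<subseteq> (\<Union>b\<in>Basis.
      {x \<in> {x \<in> U. ?D x b \<noteq> 0}. x + (r x - x \<bullet> b) *\<^sub>R b \<in> {y. b \<bullet> y = 0}})"
    using smooth_submersionD(2)[OF r] by (fastforce simp: inner_add_right inner_commute)
  ultimately show ?thesis by (rule negligible_subset)
qed

text \<open>A defining function is given only near each point of \<open>\<Gamma>\<close>, and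
  infinitely many may be required. Negligibility is nonetheless a local property, since countably
  many of the neighbourhoods cover.\<close>

lemma divides_domain_negligible:
  assumes "divides_domain \<Gamma> \<Omega> \<Omega>\<^sub>l \<Omega>\<^sub>n"
  shows "negligible \<Gamma>"
  unfolding locally_negligible_alt[of \<Gamma>]
proof
  fix x assume "x \<in> \<Gamma>"
  with assms obtain U r where U: "x \<in> U" "smooth_submersion U r" "\<Gamma> \<inter> U = {y\<in>U. r y = 0}"
    unfolding divides_domain_def by metis
  have "openin (top_of_set \<Gamma>) (\<Gamma> \<inter> U)"
    using U(2) by (auto simp: smooth_submersion_def)
  then show "\<exists>U. openin (top_of_set \<Gamma>) U \<and> x \<in> U \<and> negligible U"
    using U \<open>x \<in> \<Gamma>\<close> negligible_zero_set_submersion[OF U(2)] by (metis IntI)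
qed

section \<open>Positivity and contractivity of the heat semigroup\<close>

subsection \<open>Square integrable functions\<close>

lemma L2_funD:
  assumes "L2_fun U f"
  shows "f \<in> borel_measurable (lebesgue_on U)" "integrable (lebesgue_on U) (\<lambda>x. (norm (f x))\<^sup>2)"
  using assms by (auto simp: L2_fun_def)

lemma L2_fun_bound:
  assumes f: "L2_fun U f" and g: "g \<in> borel_measurable (lebesgue_on U)"
    and le: "\<And>x. norm (g x) \<le> c * norm (f x)"
  shows "L2_fun U g"
  unfolding L2_fun_def
proof
  show "integrable (lebesgue_on U) (\<lambda>x. (norm (g x))\<^sup>2)"
  proof (rule Bochner_Integration.integrable_bound)
    show "integrable (lebesgue_on U) (\<lambda>x. c\<^sup>2 * (norm (f x))\<^sup>2)" using L2_funD[OF f] by simp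
    show "AE x in lebesgue_on U. norm ((norm (g x))\<^sup>2) \<le> norm (c\<^sup>2 * (norm (f x))\<^sup>2)"
      using power_mono[OF le norm_ge_zero, of _ 2] by (simp add: power_mult_distrib)
  qed (use g in simp)
qed (rule g)

lemma L2_fun_add:
  assumes f: "L2_fun U f" and g: "L2_fun U g"
  shows "L2_fun U (\<lambda>x. f x + g x)"
  unfolding L2_fun_def
proof
  note [measurable] = L2_funD(1)[OF f] L2_funD(1)[OF g]
  show m: "(\<lambda>x. f x + g x) \<in> borel_measurable (lebesgue_on U)" by simp
  show "integrable (lebesgue_on U) (\<lambda>x. (norm (f x + g x))\<^sup>2)"
  proof (rule Bochner_Integration.integrable_bound)
    show "integrable (lebesgue_on U) (\<lambda>x. 2 * (norm (f x))\<^sup>2 + 2 * (norm (g x))\<^sup>2)"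
      using L2_funD(2)[OF f] L2_funD(2)[OF g] by simp
    have "(norm (f x + g x))\<^sup>2 \<le> 2 * (norm (f x))\<^sup>2 + 2 * (norm (g x))\<^sup>2" for x
    proof -
      have "(norm (f x + g x))\<^sup>2 \<le> (norm (f x) + norm (g x))\<^sup>2"
        by (intro power_mono norm_triangle_ineq) simp
      also have "\<dots> \<le> 2 * (norm (f x))\<^sup>2 + 2 * (norm (g x))\<^sup>2"
        using sum_squares_bound[of "norm (f x)" "norm (g x)"] by (simp add: power2_sum)
      finally show ?thesis .
    qed
    then show "AE x in lebesgue_on U. norm ((norm (f x + g x))\<^sup>2)
        \<le> norm (2 * (norm (f x))\<^sup>2 + 2 * (norm (g x))\<^sup>2)" by simp
  qed (use m in simp)
qed

lemma L2_fun_scaleR: "L2_fun U f \<Longrightarrow> L2_fun U (\<lambda>x. c *\<^sub>R f x)"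
  by (rule L2_fun_bound[where c = "\<bar>c\<bar>"]) (auto dest: L2_funD(1))

lemma L2_fun_diff: "L2_fun U f \<Longrightarrow> L2_fun U g \<Longrightarrow> L2_fun U (\<lambda>x. f x - g x)"
  using L2_fun_add[of U f "\<lambda>x. - 1 *\<^sub>R g x"] L2_fun_scaleR[of U g "- 1"] by simp

lemma L2_fun_norm: "L2_fun U f \<Longrightarrow> L2_fun U (\<lambda>x. norm (f x))"
  by (rule L2_fun_bound[where c = 1]) (auto dest: L2_funD(1))

lemma L2_fun_inner_integrable:
  assumes f: "L2_fun U f" and g: "L2_fun U g"
  shows "integrable (lebesgue_on U) (\<lambda>x. f x \<bullet> g x)"
proof (rule Bochner_Integration.integrable_bound)
  note [measurable] = L2_funD(1)[OF f] L2_funD(1)[OF g]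
  show "(\<lambda>x. f x \<bullet> g x) \<in> borel_measurable (lebesgue_on U)" by simp
  show "integrable (lebesgue_on U) (\<lambda>x. (norm (f x))\<^sup>2 + (norm (g x))\<^sup>2)"
    using L2_funD(2)[OF f] L2_funD(2)[OF g] by simp
  have "\<bar>f x \<bullet> g x\<bar> \<le> (norm (f x))\<^sup>2 + (norm (g x))\<^sup>2" for x
  proof -
    have "\<bar>f x \<bullet> g x\<bar> \<le> norm (f x) * norm (g x)" by (rule Cauchy_Schwarz_ineq2)
    also have "\<dots> \<le> (norm (f x))\<^sup>2 + (norm (g x))\<^sup>2"
      using sum_squares_bound[of "norm (f x)" "norm (g x)"]
        mult_nonneg_nonneg[OF norm_ge_zero[of "f x"] norm_ge_zero[of "g x"]] by linarith
    finally show ?thesis .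
  qed
  then show "AE x in lebesgue_on U. norm (f x \<bullet> g x) \<le> norm ((norm (f x))\<^sup>2 + (norm (g x))\<^sup>2)" by simp
qed

lemma L2_fun_mult_integrable:
  fixes f g :: "'a::euclidean_space \<Rightarrow> real"
  shows "L2_fun U f \<Longrightarrow> L2_fun U g \<Longrightarrow> integrable (lebesgue_on U) (\<lambda>x. f x * g x)"
  using L2_fun_inner_integrable[of U f g] by simp

text \<open>Pairing with a fixed square integrable function is how L2 convergence gets used. Young's
  inequality with a free parameter \<open>d\<close> takes the place of the Cauchy-Schwarz inequality
  for integrals.\<close>

lemma L2_tendsto_weighted:
  assumes f: "L2_fun U f" and F: "\<forall>\<^sub>F i in K. L2_fun U (F i)" and g: "L2_fun U g"
    and lim: "L2_tendsto U F g K"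
  shows "((\<lambda>i. LINT x|lebesgue_on U. norm (f x) * norm (F i x - g x)) \<longlongrightarrow> 0) K"
proof (rule tendstoI)
  fix e :: real assume e: "e > 0"
  define A where "A = (LINT x|lebesgue_on U. (norm (f x))\<^sup>2)"
  have A: "A \<ge> 0" unfolding A_def by (rule Bochner_Integration.integral_nonneg) simp
  \<comment> \<open>The two terms of Young's inequality are then at most \<open>d * A / 2\<close>
    and \<open>d / 2\<close>, with sum \<open>e / 2\<close>; the summand 1 covers
    \<open>A = 0\<close>.\<close>
  define d where "d = e / (A + 1)"
  have d: "d > 0" using e A by (simp add: d_def)
  have "\<forall>\<^sub>F i in K. (LINT x|lebesgue_on U. (norm (F i x - g x))\<^sup>2) < d\<^sup>2"
    using lim d by (intro order_tendstoD(2)) (auto simp: L2_tendsto_def)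
  with F show "\<forall>\<^sub>F i in K. dist (LINT x|lebesgue_on U. norm (f x) * norm (F i x - g x)) 0 < e"
  proof eventually_elim
    case (elim i)
    have D: "L2_fun U (\<lambda>x. F i x - g x)" by (rule L2_fun_diff[OF elim(1) g])
    have "(LINT x|lebesgue_on U. norm (f x) * norm (F i x - g x))
        \<le> (LINT x|lebesgue_on U. d / 2 * (norm (f x))\<^sup>2 + 1 / (2 * d) * (norm (F i x - g x))\<^sup>2)"
    proof (rule integral_mono)
      show "integrable (lebesgue_on U) (\<lambda>x. norm (f x) * norm (F i x - g x))"
        using L2_fun_mult_integrable[OF L2_fun_norm[OF f] L2_fun_norm[OF D]] .
      show "integrable (lebesgue_on U)
          (\<lambda>x. d / 2 * (norm (f x))\<^sup>2 + 1 / (2 * d) * (norm (F i x - g x))\<^sup>2)"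
        using L2_funD(2)[OF f] L2_funD(2)[OF D] by simp
      show "norm (f x) * norm (F i x - g x)
          \<le> d / 2 * (norm (f x))\<^sup>2 + 1 / (2 * d) * (norm (F i x - g x))\<^sup>2" for x
        using sum_squares_bound[of "d * norm (f x)" "norm (F i x - g x)"] d
        by (simp add: field_simps power2_eq_square)
    qed
    also have "\<dots> = d / 2 * A + 1 / (2 * d) * (LINT x|lebesgue_on U. (norm (F i x - g x))\<^sup>2)"
      unfolding A_def using L2_funD(2)[OF f] L2_funD(2)[OF D] by simp
    also have "\<dots> \<le> d / 2 * A + 1 / (2 * d) * d\<^sup>2"
      using elim(2) d by (intro add_left_mono mult_left_mono) auto
    also have "\<dots> = e / 2"
    proof -
      have "d * (A + 1) = e" using A by (simp add: d_def)
      moreover have "1 / (2 * d) * d\<^sup>2 = d / 2" using d by (simp add: power2_eq_square)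
      ultimately show ?thesis by (simp add: algebra_simps)
    qed
    also have "\<dots> < e" using e by simp
    finally have "(LINT x|lebesgue_on U. norm (f x) * norm (F i x - g x)) < e" .
    moreover have "(LINT x|lebesgue_on U. norm (f x) * norm (F i x - g x)) \<ge> 0"
      by (rule Bochner_Integration.integral_nonneg) simp
    ultimately show ?case by simp
  qed
qed

subsection \<open>Energy estimate\<close>

lemma test_pair_imp_H1D: "test_pair U D \<phi> \<psi> \<Longrightarrow> H1D U D \<phi> \<psi>"
  unfolding H1D_def L2_tendsto_def
  by (auto simp: test_pair_def intro!: exI[of _ "\<lambda>_. \<phi>"] exI[of _ "\<lambda>_. \<psi>"])

text \<open>Here \<open>H\<close> is a convex energy density, \<open>k\<close> its derivative and
  \<open>k'\<close> its second derivative. The bound on \<open>k'\<close> makes \<open>H\<close>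
  grow at most quadratically and \<open>k\<close> at most linearly, so that both are defined along
  L2 functions.\<close>

locale convex_profile =
  fixes H k k' :: "real \<Rightarrow> real" and C :: real
  assumes H: "\<And>s. (H has_real_derivative k s) (at s)"
    and k: "\<And>s. (k has_real_derivative k' s) (at s)"
    and cont_k': "continuous_on UNIV k'"
    and k'_bounds: "\<And>s. 0 \<le> k' s" "\<And>s. k' s \<le> C"
    and zero: "H 0 = 0" "k 0 = 0"
begin

lemma cont: "continuous_on UNIV H" "continuous_on UNIV k"
  using H k by (meson DERIV_continuous_on has_field_derivative_at_within)+

lemma C_nonneg: "C \<ge> 0" using k'_bounds[of 0] by simp

lemma k_lipschitz: "\<bar>k b - k a\<bar> \<le> C * \<bar>b - a\<bar>"
  using field_differentiable_bound[of UNIV k k' C b a] k k'_bounds by auto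

text \<open>The mean value theorem combined with the Lipschitz bound for \<open>k\<close>. The
  quadratic remainder is what permits differentiating the energy along curves that are
  differentiable only in L2.\<close>

lemma taylor: "\<bar>H b - H a - k a * (b - a)\<bar> \<le> C * (b - a)\<^sup>2"
proof -
  have "\<exists>z. \<bar>z - a\<bar> \<le> \<bar>b - a\<bar> \<and> H b - H a = k z * (b - a)"
  proof (cases a b rule: linorder_cases)
    case less
    then show ?thesis using MVT2[OF less, of H k] H by (force simp: algebra_simps)
  next
    case greater
    then obtain z where "b < z" "z < a" "H a - H b = (a - b) * k z" using MVT2[OF greater, of H k] H by blast
    then show ?thesis by (intro exI[of _ z]) (auto simp: algebra_simps)
  qed auto
  then obtain z where z: "\<bar>z - a\<bar> \<le> \<bar>b - a\<bar>" "H b - H a = k z * (b - a)" by blast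
  have "\<bar>H b - H a - k a * (b - a)\<bar> = \<bar>k z - k a\<bar> * \<bar>b - a\<bar>"
    using z by (simp add: abs_mult flip: left_diff_distrib)
  also have "\<dots> \<le> (C * \<bar>b - a\<bar>) * \<bar>b - a\<bar>"
    using k_lipschitz[of z a] z mult_left_mono[OF z(1) C_nonneg] by (intro mult_right_mono) auto
  finally show ?thesis by (simp add: power2_eq_square)
qed

lemma L2_fun_k: "L2_fun U u \<Longrightarrow> L2_fun U (\<lambda>x. k (u x))"
  by (rule L2_fun_bound[of U u _ C, OF _ borel_measurable_continuous_on[OF cont(2) L2_funD(1)]])
    (use k_lipschitz[of _ 0] zero in simp_all)

lemma integrable_H:
  assumes u: "L2_fun U u"
  shows "integrable (lebesgue_on U) (\<lambda>x. H (u x))"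
proof (rule Bochner_Integration.integrable_bound)
  show "integrable (lebesgue_on U) (\<lambda>x. C * (norm (u x))\<^sup>2)" using L2_funD(2)[OF u] by simp
  show "(\<lambda>x. H (u x)) \<in> borel_measurable (lebesgue_on U)"
    by (rule borel_measurable_continuous_on[OF cont(1) L2_funD(1)[OF u]])
  show "AE x in lebesgue_on U. norm (H (u x)) \<le> norm (C * (norm (u x))\<^sup>2)"
    using taylor[of _ 0] zero C_nonneg by simp
qed

text \<open>In other words, \<open>k (u x)\<close> is the L2 gradient of the energy. Its time
  derivative along the flow therefore involves no derivative in time at individual points
  \<open>x\<close>.\<close>

lemma integral_H_diff:
  assumes u: "L2_fun U u" and v: "L2_fun U v"
  shows "\<bar>(LINT x|lebesgue_on U. H (v x)) - (LINT x|lebesgue_on U. H (u x))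
      - (LINT x|lebesgue_on U. k (u x) * (v x - u x))\<bar> \<le> C * (LINT x|lebesgue_on U. (v x - u x)\<^sup>2)"
proof -
  have d: "L2_fun U (\<lambda>x. v x - u x)" by (rule L2_fun_diff[OF v u])
  note int = integrable_H[OF v] integrable_H[OF u] L2_fun_mult_integrable[OF L2_fun_k[OF u] d]
  have "(LINT x|lebesgue_on U. H (v x)) - (LINT x|lebesgue_on U. H (u x))
      - (LINT x|lebesgue_on U. k (u x) * (v x - u x))
      = (LINT x|lebesgue_on U. H (v x) - H (u x) - k (u x) * (v x - u x))"
    using int by simp
  also have "\<bar>\<dots>\<bar> \<le> (LINT x|lebesgue_on U. norm (H (v x) - H (u x) - k (u x) * (v x - u x)))"
    using integral_norm_bound by fastforce
  also have "\<dots> \<le> (LINT x|lebesgue_on U. C * (v x - u x)\<^sup>2)"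
    using int L2_funD(2)[OF d] taylor by (intro integral_mono integrable_norm) auto
  finally show ?thesis by simp
qed

text \<open>Each assumption of the locale preserves one clause of admissibility: continuity of
  \<open>k'\<close> that of the gradient, the bound \<open>C\<close> square integrability, and
  \<open>k 0 = 0\<close> the vanishing near \<open>D\<close>.\<close>

lemma test_pair_k:
  assumes "test_pair U D \<phi> \<psi>"
  shows "test_pair U D (\<lambda>x. k (\<phi> x)) (\<lambda>x. k' (\<phi> x) *\<^sub>R \<psi> x)"
  unfolding test_pair_def
proof (intro conjI ballI)
  have \<phi>: "\<And>x. x \<in> U \<Longrightarrow> GDERIV \<phi> x :> \<psi> x" and \<psi>: "continuous_on U \<psi>"
    and L2: "L2_fun U \<phi>" "L2_fun U \<psi>"
    and W: "\<exists>W. open W \<and> D \<subseteq> W \<and> (\<forall>x\<in>U \<inter> W. \<phi> x = 0)"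
    using assms by (auto simp: test_pair_def)
  show "GDERIV (\<lambda>x. k (\<phi> x)) x :> k' (\<phi> x) *\<^sub>R \<psi> x" if "x \<in> U" for x
    by (rule GDERIV_DERIV_compose[OF \<phi>[OF that] k])
  have "continuous_on U \<phi>"
    using \<phi> by (auto simp: gderiv_def intro!: continuous_at_imp_continuous_on has_derivative_continuous)
  then have "continuous_on U (\<lambda>x. k' (\<phi> x))"
    by (rule continuous_on_compose2[OF cont_k']) simp
  then show "continuous_on U (\<lambda>x. k' (\<phi> x) *\<^sub>R \<psi> x)"
    by (intro continuous_on_scaleR \<psi>)
  show "L2_fun U (\<lambda>x. k (\<phi> x))" by (rule L2_fun_k[OF L2(1)])
  show "L2_fun U (\<lambda>x. k' (\<phi> x) *\<^sub>R \<psi> x)"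
  proof (rule L2_fun_bound[OF L2(2)])
    show "(\<lambda>x. k' (\<phi> x) *\<^sub>R \<psi> x) \<in> borel_measurable (lebesgue_on U)"
      using borel_measurable_continuous_on[OF cont_k' L2_funD(1)[OF L2(1)]] L2_funD(1)[OF L2(2)]
      by (rule borel_measurable_scaleR)
    show "norm (k' (\<phi> x) *\<^sub>R \<psi> x) \<le> C * norm (\<psi> x)" for x
      using k'_bounds[of "\<phi> x"] by (simp add: mult_right_mono)
  qed
  show "\<exists>W. open W \<and> D \<subseteq> W \<and> (\<forall>x\<in>U \<inter> W. k (\<phi> x) = 0)" using W zero by metis
qed

text \<open>Testing with \<open>k(\<phi>\<^sub>n)\<close> for \<open>\<phi>\<^sub>n \<rightarrow> u\<close>, rather than with \<open>k(u)\<close>, avoids the chain rule for weak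
  gradients.\<close>

lemma mixed_laplacian_dissipative:
  assumes "mixed_laplacian U D u w"
  shows "(LINT x|lebesgue_on U. w x * k (u x)) \<le> 0"
proof -
  obtain g where w: "L2_fun U w" and H1: "H1D U D u g"
    and weak: "\<And>\<phi> \<psi>. H1D U D \<phi> \<psi> \<Longrightarrow>
       (LINT x|lebesgue_on U. g x \<bullet> \<psi> x) = - (LINT x|lebesgue_on U. w x * \<phi> x)"
    using assms unfolding mixed_laplacian_def by blast
  obtain \<phi> \<psi> where u: "L2_fun U u" and g: "L2_fun U g"
    and test: "\<And>n::nat. test_pair U D (\<phi> n) (\<psi> n)"
    and lim: "L2_tendsto U \<phi> u sequentially" "L2_tendsto U \<psi> g sequentially"
    using H1 unfolding H1D_def by blast
  have \<phi>: "L2_fun U (\<phi> n)" and \<psi>: "L2_fun U (\<psi> n)" for n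
    using test[of n] by (auto simp: test_pair_def)
  have tk: "L2_fun U (\<lambda>x. k' (\<phi> n x) *\<^sub>R \<psi> n x)" for n
    using test_pair_k[OF test[of n]] by (auto simp: test_pair_def)
  define e where "e n = (LINT x|lebesgue_on U. w x * k (\<phi> n x))" for n
  define c where "c n = (LINT x|lebesgue_on U. norm (g x) * norm (\<psi> n x - g x))" for n
  have e_eq: "e n = - (LINT x|lebesgue_on U. g x \<bullet> (k' (\<phi> n x) *\<^sub>R \<psi> n x))" for n
    using weak[OF test_pair_imp_H1D[OF test_pair_k[OF test[of n]]]] by (simp add: e_def)
  \<comment> \<open>Writing \<open>\<psi> n\<close> as \<open>g\<close> plus an error leaves
    \<open>k' (\<phi> n x)\<close> times the squared norm of \<open>g x\<close>, which has a sign,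
    and an error bounded through \<open>C\<close>. Hence no limit of \<open>k' (\<phi> n x)\<close>
    has to be taken.\<close>
  have e_le: "e n \<le> C * c n" for n
  proof -
    have "- (g x \<bullet> (k' (\<phi> n x) *\<^sub>R \<psi> n x)) \<le> C * (norm (g x) * norm (\<psi> n x - g x))" for x
    proof -
      have "g x \<bullet> (k' (\<phi> n x) *\<^sub>R \<psi> n x) = k' (\<phi> n x) * (norm (g x))\<^sup>2 + k' (\<phi> n x) * (g x \<bullet> (\<psi> n x - g x))"
        by (simp add: power2_norm_eq_inner inner_diff_right algebra_simps)
      moreover have "k' (\<phi> n x) * (norm (g x))\<^sup>2 \<ge> 0" using k'_bounds by simp
      moreover have "\<bar>k' (\<phi> n x) * (g x \<bullet> (\<psi> n x - g x))\<bar> \<le> C * (norm (g x) * norm (\<psi> n x - g x))"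
        unfolding abs_mult using k'_bounds[of "\<phi> n x"] by (intro mult_mono Cauchy_Schwarz_ineq2) auto
      ultimately show ?thesis by linarith
    qed
    then have "(LINT x|lebesgue_on U. - (g x \<bullet> (k' (\<phi> n x) *\<^sub>R \<psi> n x)))
        \<le> (LINT x|lebesgue_on U. C * (norm (g x) * norm (\<psi> n x - g x)))"
      using L2_fun_inner_integrable[OF g tk[of n]]
        L2_fun_mult_integrable[OF L2_fun_norm[OF g] L2_fun_norm[OF L2_fun_diff[OF \<psi> g]]]
      by (intro integral_mono) auto
    then show ?thesis unfolding e_eq c_def by simp
  qed
  have c: "c \<longlonglongrightarrow> 0"
    unfolding c_def by (rule L2_tendsto_weighted[OF g _ g lim(2)]) (simp add: \<psi>)
  have "(\<lambda>n. C * (LINT x|lebesgue_on U. norm (w x) * norm (\<phi> n x - u x))) \<longlonglongrightarrow> C * 0"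
    by (intro tendsto_mult_left L2_tendsto_weighted[OF w _ u lim(1)]) (simp add: \<phi>)
  then have lim_w: "(\<lambda>n. C * (LINT x|lebesgue_on U. norm (w x) * norm (\<phi> n x - u x))) \<longlonglongrightarrow> 0" by simp
  have "norm (e n - (LINT x|lebesgue_on U. w x * k (u x)))
      \<le> C * (LINT x|lebesgue_on U. norm (w x) * norm (\<phi> n x - u x))" for n
  proof -
    note int = L2_fun_mult_integrable[OF w L2_fun_k[OF \<phi>[of n]]] L2_fun_mult_integrable[OF w L2_fun_k[OF u]]
    have "e n - (LINT x|lebesgue_on U. w x * k (u x))
        = (LINT x|lebesgue_on U. w x * k (\<phi> n x) - w x * k (u x))"
      using int by (simp add: e_def)
    also have "norm \<dots> \<le> (LINT x|lebesgue_on U. norm (w x * k (\<phi> n x) - w x * k (u x)))"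
      by (rule integral_norm_bound)
    also have "\<dots> \<le> (LINT x|lebesgue_on U. C * (norm (w x) * norm (\<phi> n x - u x)))"
    proof (rule integral_mono)
      show "integrable (lebesgue_on U) (\<lambda>x. norm (w x * k (\<phi> n x) - w x * k (u x)))"
        using int by (intro integrable_norm Bochner_Integration.integrable_diff)
      show "integrable (lebesgue_on U) (\<lambda>x. C * (norm (w x) * norm (\<phi> n x - u x)))"
        using L2_fun_mult_integrable[OF L2_fun_norm[OF w] L2_fun_norm[OF L2_fun_diff[OF \<phi>[of n] u]]] by simp
      show "norm (w x * k (\<phi> n x) - w x * k (u x)) \<le> C * (norm (w x) * norm (\<phi> n x - u x))" for x
        using mult_left_mono[OF k_lipschitz[of "\<phi> n x" "u x"] abs_ge_zero[of "w x"]]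
        by (simp add: mult_ac flip: abs_mult right_diff_distrib)
    qed
    finally show ?thesis by simp
  qed
  then have "(\<lambda>n. e n - (LINT x|lebesgue_on U. w x * k (u x))) \<longlonglongrightarrow> 0"
    by (intro Lim_null_comparison[OF always_eventually lim_w] allI)
  then have "e \<longlonglongrightarrow> (LINT x|lebesgue_on U. w x * k (u x))" by (rule LIM_zero_cancel)
  moreover have "(\<lambda>n. C * c n) \<longlonglongrightarrow> C * 0" by (intro tendsto_mult_left c)
  ultimately have "(LINT x|lebesgue_on U. w x * k (u x)) \<le> C * 0"
    by (rule LIMSEQ_le) (use e_le in auto)
  then show ?thesis by simp
qed

text \<open>For positive times the derivative of the energy is the integral of \<open>k (u)\<close>
  times the Laplacian, which dissipativity makes nonpositive. The orbit need not be differentiable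
  at time 0, so that endpoint is reached through the L2 continuity of the orbit there.\<close>

lemma energy_decreasing:
  assumes S: "heat_semigroup U D S" and f: "f \<in> L1_on U" "L2_fun U (rep_L1 f)" and t: "t \<ge> 0"
  shows "(LINT x|lebesgue_on U. H (rep_L1 (S t f) x)) \<le> (LINT x|lebesgue_on U. H (rep_L1 f x))"
proof -
  define u where "u t = rep_L1 (S t f)" for t
  define \<Phi> where "\<Phi> t = (LINT x|lebesgue_on U. H (u t x))" for t
  have L2: "L2_fun U (u t)" if "t \<ge> 0" for t
    using S f that unfolding heat_semigroup_def u_def by blast
  have u0: "u 0 = rep_L1 f"
    using S f(1) unfolding heat_semigroup_def C0_semigroup_def u_def by auto
  have lim0: "L2_tendsto U u (u 0) (at_right 0)"
    using S f unfolding heat_semigroup_def u0 unfolding u_def by blast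
  have deriv: "\<exists>y. (\<Phi> has_real_derivative y) (at t) \<and> y \<le> 0" if t: "t > 0" for t
  proof -
    obtain w where w: "mixed_laplacian U D (u t) w"
      and lim: "L2_tendsto U (\<lambda>h x. (u (t + h) x - u t x) / h) w (at 0)"
      using S f t unfolding heat_semigroup_def u_def by blast
    have wL2: "L2_fun U w" using w by (simp add: mixed_laplacian_def)
    have ut: "L2_fun U (u t)" using L2 t by simp
    define q where "q h x = (u (t + h) x - u t x) / h" for h x
    have "\<forall>\<^sub>F h in at (0::real). - t < h" using t by (intro order_tendstoD(1)[OF tendsto_ident_at]) simp
    then have near: "\<forall>\<^sub>F h in at (0::real). - t < h \<and> h \<noteq> 0"
      using eventually_at_filter by (auto elim: eventually_mono simp: eventually_at_filter)
    have q: "L2_fun U (q h)" if "- t < h" for h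
      using L2_fun_scaleR[OF L2_fun_diff[OF L2[of "t + h"] ut], of "1 / h"] that
      by (simp add: q_def[abs_def])
    have qw: "L2_fun U (\<lambda>x. q h x - w x)" if "- t < h" for h by (rule L2_fun_diff[OF q[OF that] wL2])
    have near': "\<forall>\<^sub>F h in at 0. L2_fun U (q h)" using near by eventually_elim (simp add: q)
    define a where "a h = (LINT x|lebesgue_on U. norm (k (u t x)) * norm (q h x - w x))" for h
    define b where "b h = (LINT x|lebesgue_on U. (norm (q h x - w x))\<^sup>2)" for h
    define W where "W = (LINT x|lebesgue_on U. (norm (w x))\<^sup>2)"
    have a: "(a \<longlongrightarrow> 0) (at 0)"
      unfolding a_def using lim near'
      by (intro L2_tendsto_weighted L2_fun_k[OF ut] wL2) (simp_all add: q_def[abs_def])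
    have b: "(b \<longlongrightarrow> 0) (at 0)"
      using lim unfolding b_def L2_tendsto_def q_def .
    \<comment> \<open>The Taylor remainder is quadratic in \<open>h * q h x\<close>. The quotients
      \<open>q h\<close> stay bounded in L2 because they converge to \<open>w\<close>, so division
      by \<open>h\<close> leaves a term of order \<open>h\<close>. The condition
      \<open>- t < h\<close> keeps the time \<open>t + h\<close> positive.\<close>
    have bound: "norm ((\<Phi> (t + h) - \<Phi> t) / h - (LINT x|lebesgue_on U. k (u t x) * w x))
        \<le> a h + C * \<bar>h\<bar> * (2 * b h + 2 * W)" if h: "- t < h" "h \<noteq> 0" for h
    proof -
      note int = L2_fun_mult_integrable[OF L2_fun_k[OF ut] q[OF h(1)]] L2_fun_mult_integrable[OF L2_fun_k[OF ut] wL2]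
      have uq: "u (t + h) x - u t x = h * q h x" for x using h by (simp add: q_def)
      have "\<bar>\<Phi> (t + h) - \<Phi> t - h * (LINT x|lebesgue_on U. k (u t x) * q h x)\<bar>
          \<le> C * (h\<^sup>2 * (LINT x|lebesgue_on U. (q h x)\<^sup>2))"
        using integral_H_diff[OF ut L2[of "t + h"]] h
        by (simp add: \<Phi>_def uq power_mult_distrib mult.left_commute)
      also have "(LINT x|lebesgue_on U. (q h x)\<^sup>2)
          \<le> (LINT x|lebesgue_on U. 2 * (norm (q h x - w x))\<^sup>2 + 2 * (norm (w x))\<^sup>2)"
      proof (rule integral_mono)
        show "integrable (lebesgue_on U) (\<lambda>x. (q h x)\<^sup>2)" using L2_funD(2)[OF q[OF h(1)]] by simp
        show "integrable (lebesgue_on U) (\<lambda>x. 2 * (norm (q h x - w x))\<^sup>2 + 2 * (norm (w x))\<^sup>2)"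
          using L2_funD(2)[OF qw[OF h(1)]] L2_funD(2)[OF wL2] by simp
        show "(q h x)\<^sup>2 \<le> 2 * (norm (q h x - w x))\<^sup>2 + 2 * (norm (w x))\<^sup>2" for x
          using sum_squares_bound[of "q h x - w x" "w x"] by (simp add: power2_eq_square algebra_simps)
      qed
      also have "\<dots> = 2 * b h + 2 * W"
        using L2_funD(2)[OF qw[OF h(1)]] L2_funD(2)[OF wL2] by (simp add: b_def W_def)
      finally have 1: "\<bar>\<Phi> (t + h) - \<Phi> t - h * (LINT x|lebesgue_on U. k (u t x) * q h x)\<bar>
          \<le> C * (h\<^sup>2 * (2 * b h + 2 * W))"
        using C_nonneg by (simp add: mult_left_mono)
      have "(\<Phi> (t + h) - \<Phi> t) / h - (LINT x|lebesgue_on U. k (u t x) * q h x)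
          = (\<Phi> (t + h) - \<Phi> t - h * (LINT x|lebesgue_on U. k (u t x) * q h x)) / h"
        using h by (simp add: field_simps)
      then have "\<bar>(\<Phi> (t + h) - \<Phi> t) / h - (LINT x|lebesgue_on U. k (u t x) * q h x)\<bar>
          \<le> C * (h\<^sup>2 * (2 * b h + 2 * W)) / \<bar>h\<bar>"
        using 1 h by (simp add: divide_right_mono)
      also have "\<dots> = C * \<bar>h\<bar> * (2 * b h + 2 * W)"
        using h by (simp add: field_simps power2_eq_square)
      finally have 2: "\<bar>(\<Phi> (t + h) - \<Phi> t) / h - (LINT x|lebesgue_on U. k (u t x) * q h x)\<bar>
          \<le> C * \<bar>h\<bar> * (2 * b h + 2 * W)" .
      have "(LINT x|lebesgue_on U. k (u t x) * q h x) - (LINT x|lebesgue_on U. k (u t x) * w x)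
          = (LINT x|lebesgue_on U. k (u t x) * (q h x - w x))"
        using int by (simp add: right_diff_distrib)
      moreover have "\<bar>(LINT x|lebesgue_on U. k (u t x) * (q h x - w x))\<bar> \<le> a h"
        using integral_norm_bound[of "lebesgue_on U" "\<lambda>x. k (u t x) * (q h x - w x)"]
        by (simp add: a_def abs_mult)
      ultimately show ?thesis using 2 by simp
    qed
    have "((\<lambda>h. (\<Phi> (t + h) - \<Phi> t) / h - (LINT x|lebesgue_on U. k (u t x) * w x)) \<longlongrightarrow> 0) (at 0)"
    proof (rule Lim_null_comparison)
      show "\<forall>\<^sub>F h in at 0. norm ((\<Phi> (t + h) - \<Phi> t) / h - (LINT x|lebesgue_on U. k (u t x) * w x))
          \<le> a h + C * \<bar>h\<bar> * (2 * b h + 2 * W)"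
        using near by eventually_elim (rule bound, auto)
      have "((\<lambda>h. a h + C * \<bar>h\<bar> * (2 * b h + 2 * W)) \<longlongrightarrow> 0 + C * \<bar>0\<bar> * (2 * 0 + 2 * W)) (at 0)"
        by (intro tendsto_intros a b)
      then show "((\<lambda>h. a h + C * \<bar>h\<bar> * (2 * b h + 2 * W)) \<longlongrightarrow> 0) (at 0)" by simp
    qed
    then have "(\<Phi> has_real_derivative (LINT x|lebesgue_on U. k (u t x) * w x)) (at t)"
      unfolding DERIV_def by (rule LIM_zero_cancel)
    moreover have "(LINT x|lebesgue_on U. k (u t x) * w x) \<le> 0"
      using mixed_laplacian_dissipative[OF w] by (simp add: mult.commute)
    ultimately show ?thesis by blast
  qed
  have "(\<Phi> \<longlongrightarrow> \<Phi> 0) (at_right 0)"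
  proof (rule LIM_zero_cancel, rule Lim_null_comparison)
    define a where "a s = (LINT x|lebesgue_on U. norm (k (u 0 x)) * norm (u s x - u 0 x))" for s
    define b where "b s = (LINT x|lebesgue_on U. (norm (u s x - u 0 x))\<^sup>2)" for s
    have pos: "\<forall>\<^sub>F s in at_right (0::real). s > 0" by (rule eventually_at_right_less)
    show "\<forall>\<^sub>F s in at_right 0. norm (\<Phi> s - \<Phi> 0) \<le> a s + C * b s"
      using pos
    proof eventually_elim
      case (elim s)
      have "\<bar>(LINT x|lebesgue_on U. k (u 0 x) * (u s x - u 0 x))\<bar> \<le> a s"
        using integral_norm_bound[of "lebesgue_on U" "\<lambda>x. k (u 0 x) * (u s x - u 0 x)"]
        by (simp add: a_def abs_mult)
      then show ?case
        using integral_H_diff[OF L2[of 0] L2[of s]] elim by (simp add: \<Phi>_def b_def)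
    qed
    have "(a \<longlongrightarrow> 0) (at_right 0)"
      unfolding a_def
      by (rule L2_tendsto_weighted[OF L2_fun_k[OF L2] _ L2 lim0])
        (use pos in \<open>auto elim!: eventually_mono simp: L2\<close>)
    moreover have "(b \<longlongrightarrow> 0) (at_right 0)"
      using lim0 unfolding b_def L2_tendsto_def .
    ultimately have "((\<lambda>s. a s + C * b s) \<longlongrightarrow> 0 + C * 0) (at_right 0)"
      by (intro tendsto_intros)
    then show "((\<lambda>s. a s + C * b s) \<longlongrightarrow> 0) (at_right 0)" by simp
  qed
  then have "continuous (at 0 within {0..t}) \<Phi>" if "t > 0"
    using that by (simp add: continuous_within at_within_Icc_at_right)
  moreover have "continuous (at s within {0..t}) \<Phi>" if "s > 0" for s
    using deriv[OF that] DERIV_isCont continuous_at_imp_continuous_at_within by blast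
  ultimately have "continuous_on {0..t} \<Phi>" if "t > 0"
    using that by (force simp: continuous_on_eq_continuous_within order_le_less)
  then have "\<Phi> t \<le> \<Phi> 0"
    using DERIV_nonpos_imp_decreasing_open[of 0 t \<Phi>] deriv t by (cases "t = 0") auto
  then show ?thesis unfolding \<Phi>_def u0 by (simp add: u_def)
qed

end

subsection \<open>Negative parts along the flow\<close>

text \<open>Only the point 0 is critical. There the difference quotient of the cut-off function is
  either that of \<open>f\<close> or zero, hence dominated by one that tends to 0.\<close>

lemma DERIV_min_0:
  fixes f :: "real \<Rightarrow> real"
  assumes f: "\<And>s. (f has_real_derivative f' s) (at s)" and 0: "f 0 = 0" "f' 0 = 0"
  shows "((\<lambda>s. f (min s 0)) has_real_derivative f' (min s 0)) (at s)"
proof (cases s "0 :: real" rule: linorder_cases)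
  case less
  then show ?thesis
    using has_field_derivative_transform_within_open[OF f[of s] open_lessThan[of 0],
        of "\<lambda>s. f (min s 0)"] by simp
next
  case greater
  then show ?thesis
    using has_field_derivative_transform_within_open[OF DERIV_const[of "0 :: real"] open_greaterThan[of 0],
        of s "\<lambda>s. f (min s 0)"] 0 by simp
next
  case equal
  have "((\<lambda>h. (f (0 + h) - f 0) / h) \<longlongrightarrow> 0) (at 0)"
    using f[of 0] 0 by (simp add: DERIV_def)
  then have "((\<lambda>h. (f (min (0 + h) 0) - f (min 0 0)) / h) \<longlongrightarrow> 0) (at 0)"
    by (rule metric_tendsto_imp_tendsto) (auto intro!: always_eventually simp: min_def 0)
  then show ?thesis using equal 0 by (simp add: DERIV_def)
qed

text \<open>A primitive of \<open>- s\<^sup>2 / (e\<^sup>2 + s\<^sup>2)\<close> on the negative half line. Unlike that of the negative part,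
  its derivative is continuously differentiable and vanishes at zero, as the Dirichlet condition requires.\<close>

definition neg_profile :: "real \<Rightarrow> real \<Rightarrow> real"
  where "neg_profile e s = - min s 0 + e * arctan (min s 0 / e)"

text \<open>The bound \<open>2 / e\<close> blows up as \<open>e\<close> tends to 0. This is harmless
  because the conclusion of \<open>energy_decreasing\<close> does not contain
  \<open>C\<close>.\<close>

lemma convex_neg_profile:
  assumes e: "e > 0"
  shows "convex_profile (neg_profile e) (\<lambda>s. - 1 + 1 / (1 + (min s 0 / e)\<^sup>2))
    (\<lambda>s. - (2 * (min s 0 / e) / e) / (1 + (min s 0 / e)\<^sup>2)\<^sup>2) (2 / e)"
proof
  fix s :: real
  have pos: "1 + (x / e)\<^sup>2 > 0" for x by (simp add: add_pos_nonneg)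
  have "((\<lambda>x. - x + e * arctan (x / e)) has_real_derivative - 1 + 1 / (1 + (x / e)\<^sup>2)) (at x)" for x
    using e by (auto intro!: derivative_eq_intros simp: inverse_eq_divide)
  from DERIV_min_0[OF this]
  show "(neg_profile e has_real_derivative - 1 + 1 / (1 + (min s 0 / e)\<^sup>2)) (at s)"
    unfolding neg_profile_def[abs_def] by simp
  have "((\<lambda>x. - 1 + 1 / (1 + (x / e)\<^sup>2)) has_real_derivative
      - (2 * (x / e) / e) / (1 + (x / e)\<^sup>2)\<^sup>2) (at x)" for x
    using e pos[of x]
    by (auto intro!: derivative_eq_intros simp: power2_eq_square)
  from DERIV_min_0[OF this]
  show "((\<lambda>s. - 1 + 1 / (1 + (min s 0 / e)\<^sup>2)) has_real_derivative
      - (2 * (min s 0 / e) / e) / (1 + (min s 0 / e)\<^sup>2)\<^sup>2) (at s)" by simp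
  show "continuous_on UNIV (\<lambda>s. - (2 * (min s 0 / e) / e) / (1 + (min s 0 / e)\<^sup>2)\<^sup>2)"
    using pos e by (intro continuous_intros ballI) (auto simp: less_imp_neq[OF pos, symmetric])
  show "0 \<le> - (2 * (min s 0 / e) / e) / (1 + (min s 0 / e)\<^sup>2)\<^sup>2"
    using e by (simp add: divide_le_0_iff mult_nonneg_nonpos)
  define z where "z = - (min s 0 / e)"
  have "z \<le> 1 + z\<^sup>2"
    using sum_squares_bound[of 1 z] zero_le_power2[of z] unfolding power_one by linarith
  also have "\<dots> \<le> (1 + z\<^sup>2)\<^sup>2" by (rule self_le_power) auto
  finally have "z / (1 + z\<^sup>2)\<^sup>2 \<le> 1"
    using zero_less_power[OF add_pos_nonneg[OF zero_less_one zero_le_power2[of z]], of 2]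
    by (simp only: divide_le_eq_1_pos)
  then have "2 / e * (z / (1 + z\<^sup>2)\<^sup>2) \<le> 2 / e * 1"
    using e by (intro mult_left_mono) auto
  then show "- (2 * (min s 0 / e) / e) / (1 + (min s 0 / e)\<^sup>2)\<^sup>2 \<le> 2 / e"
    by (simp add: z_def)
qed (simp_all add: neg_profile_def)

lemma neg_profile_bounds:
  assumes "e > 0"
  shows "neg_profile e s \<le> max 0 (- s)" "max 0 (- s) \<le> neg_profile e s + 2 * e"
proof -
  have "arctan (min s 0 / e) \<le> 0" using assms by (simp add: divide_le_0_iff)
  then show "neg_profile e s \<le> max 0 (- s)"
    using assms mult_nonneg_nonpos[of e "arctan (min s 0 / e)"] by (simp add: neg_profile_def)
  \<comment> \<open>The arctangent exceeds minus half of pi, and pi is less than 4; this is the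
    origin of the uniform error \<open>2 * e\<close>.\<close>
  have "- 2 \<le> arctan (min s 0 / e)" using arctan_lbound[of "min s 0 / e"] pi_less_4 by linarith
  then have "e * - 2 \<le> e * arctan (min s 0 / e)" using assms by (intro mult_left_mono) auto
  then show "max 0 (- s) \<le> neg_profile e s + 2 * e" by (auto simp: neg_profile_def min_def)
qed

lemma neg_L1_on:
  assumes U: "U \<in> sets lebesgue" and f: "f \<in> L1_on U"
  shows "neg_L1 f = (LINT x|lebesgue_on U. max 0 (- rep_L1 f x))"
proof -
  have "neg_L1 f = (LINT x|lebesgue. indicator U x *\<^sub>R max 0 (- rep_L1 f x))"
    unfolding neg_L1_eq
    by (rule integral_cong_AE) (use U f in \<open>auto simp: L1_on_def elim!: eventually_mono\<close>)
  also have "\<dots> = (LINT x|lebesgue_on U. max 0 (- rep_L1 f x))"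
    using U by (simp add: integral_restrict_space)
  finally show ?thesis .
qed

text \<open>The profile differs from the negative part by at most \<open>2 * e\<close> everywhere,
  so the integrals over \<open>U\<close> differ by at most \<open>2 * e\<close> times its measure.
  The finite measure of \<open>U\<close> makes this error vanish with \<open>e\<close>.\<close>

lemma neg_heat_L2:
  fixes f :: "'a::euclidean_space L1"
  assumes S: "heat_semigroup U D S" and U: "U \<in> lmeasurable"
    and f: "f \<in> L1_on U" "L2_fun U (rep_L1 f)" and t: "t \<ge> 0"
  shows "neg_L1 (S t f) \<le> neg_L1 f"
proof (rule field_le_epsilon)
  have U': "U \<in> sets lebesgue" using U by (rule fmeasurableD)
  have Sf: "S t f \<in> L1_on U" "L2_fun U (rep_L1 (S t f))"
    using S f t unfolding heat_semigroup_def C0_semigroup_def by blast+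
  have neg: "integrable (lebesgue_on U) (\<lambda>x. max 0 (- rep_L1 g x))" for g
    using U' integrable_mult_indicator[OF U', of "\<lambda>x. max 0 (- rep_L1 g x)"]
    by (simp add: integrable_restrict_space)
  have const: "integrable (lebesgue_on U) (\<lambda>x. c)" for c :: real
  proof -
    have "integrable lebesgue (indicator U :: 'a \<Rightarrow> real)"
      using U by (intro integrable_real_indicator) (auto simp: fmeasurable_def)
    then show ?thesis using U' by (simp add: integrable_restrict_space)
  qed
  fix d :: real assume d: "d > 0"
  \<comment> \<open>The error \<open>2 * e * measure lebesgue U\<close> is then at most
    \<open>d\<close>; the summand 1 covers a null set \<open>U\<close>.\<close>
  define e where "e = d / (2 * measure lebesgue U + 1)"
  have e: "e > 0" using d by (simp add: e_def add_nonneg_pos)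
  interpret convex_profile "neg_profile e" "\<lambda>s. - 1 + 1 / (1 + (min s 0 / e)\<^sup>2)"
    "\<lambda>s. - (2 * (min s 0 / e) / e) / (1 + (min s 0 / e)\<^sup>2)\<^sup>2" "2 / e"
    by (rule convex_neg_profile[OF e])
  have "neg_L1 (S t f) \<le> (LINT x|lebesgue_on U. neg_profile e (rep_L1 (S t f) x) + 2 * e)"
    unfolding neg_L1_on[OF U' Sf(1)]
    using neg const integrable_H[OF Sf(2)] neg_profile_bounds(2)[OF e] by (intro integral_mono) auto
  also have "\<dots> = (LINT x|lebesgue_on U. neg_profile e (rep_L1 (S t f) x)) + 2 * e * measure lebesgue U"
    using const integrable_H[OF Sf(2)] U' by (simp add: measure_restrict_space)
  also have "\<dots> \<le> (LINT x|lebesgue_on U. neg_profile e (rep_L1 f x)) + 2 * e * measure lebesgue U"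
    using energy_decreasing[OF S f t] by simp
  also have "(LINT x|lebesgue_on U. neg_profile e (rep_L1 f x)) \<le> neg_L1 f"
    unfolding neg_L1_on[OF U' f(1)]
    using neg integrable_H[OF f(2)] neg_profile_bounds(1)[OF e] by (intro integral_mono) auto
  also have "2 * e * measure lebesgue U \<le> d"
  proof -
    have "e * (2 * measure lebesgue U + 1) = d"
      using measure_nonneg[of lebesgue U] by (simp add: e_def add_nonneg_eq_0_iff)
    then show ?thesis using e by (simp add: algebra_simps)
  qed
  finally show "neg_L1 (S t f) \<le> neg_L1 f + d" by simp
qed

text \<open>\<open>S t\<close> is controlled only on the subspace \<open>L1_on U\<close>. Composing
  with the projection onto it gives an operator on the whole space to which the theory of bounded
  linear maps applies.\<close>

lemma bounded_linear_semigroup_restrict: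
  assumes S: "C0_semigroup (L1_on U) S" and U: "U \<in> sets lebesgue" and t: "t \<ge> 0"
  shows "bounded_linear (\<lambda>f. S t (restrict_L1 U f))"
proof -
  have in_U: "restrict_L1 U f \<in> L1_on U" for f
    using U by (simp add: in_L1_on_iff restrict_restrict_L1)
  have "\<exists>C. \<forall>f\<in>L1_on U. norm (S t f) \<le> C * norm f"
    using S t by (simp add: C0_semigroup_def)
  then obtain C where C: "\<And>f. f \<in> L1_on U \<Longrightarrow> norm (S t f) \<le> C * norm f" by blast
  have "bounded_linear (\<lambda>f. restrict_L1 U f)" by (rule bounded_linear_restrict_L1[OF U])
  then interpret P: bounded_linear "restrict_L1 U" .
  obtain K where K: "\<And>f. norm (restrict_L1 U f) \<le> norm f * K" using P.bounded by blast
  show ?thesis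
  proof (rule bounded_linear_intro)
    fix f g and c :: real
    show "S t (restrict_L1 U (f + g)) = S t (restrict_L1 U f) + S t (restrict_L1 U g)"
      using S t in_U unfolding C0_semigroup_def by (simp add: P.add)
    show "S t (restrict_L1 U (c *\<^sub>R f)) = c *\<^sub>R S t (restrict_L1 U f)"
      using S t in_U unfolding C0_semigroup_def by (simp add: P.scaleR)
    have "norm (S t (restrict_L1 U f)) \<le> C * norm (restrict_L1 U f)" by (rule C[OF in_U])
    also have "\<dots> \<le> \<bar>C\<bar> * norm (restrict_L1 U f)" by (rule mult_right_mono) auto
    also have "\<dots> \<le> \<bar>C\<bar> * (norm f * K)" by (intro mult_left_mono K) auto
    finally show "norm (S t (restrict_L1 U f)) \<le> norm f * (K * \<bar>C\<bar>)" by (simp add: mult_ac)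
  qed
qed

lemma tendsto_neg_L1:
  assumes "(f \<longlongrightarrow> l) F"
  shows "((\<lambda>x. neg_L1 (f x)) \<longlongrightarrow> neg_L1 l) F"
  unfolding neg_L1_def
  by (intro tendsto_intros assms bounded_linear.tendsto[OF bounded_linear_int_L1]) simp

text \<open>The truncation of \<open>f\<close> at height \<open>n\<close> is square integrable since
  its square is at most \<open>n\<close> times the absolute value of \<open>f\<close>, and it still
  vanishes off \<open>U\<close>. Truncations converge in L1 by dominated convergence, and both sides
  of the inequality are continuous in L1.\<close>

lemma neg_heat:
  fixes f :: "'a::euclidean_space L1"
  assumes S: "heat_semigroup U D S" and U: "U \<in> lmeasurable" and t: "t \<ge> 0" and f: "f \<in> L1_on U"
  shows "neg_L1 (S t f) \<le> neg_L1 f"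
proof -
  have U': "U \<in> sets lebesgue" using U by (rule fmeasurableD)
  define c where "c n x = max (- real n) (min (rep_L1 f x) (real n))" for n x
  have c [simp]: "integrable lebesgue (c n)" for n
    unfolding c_def
    by (rule Bochner_Integration.integrable_bound[OF integrable_rep_L1[of f]]) auto
  define g where "g n = abs_L1 (c n)" for n
  have g: "AE x in lebesgue. rep_L1 (g n) x = c n x" for n unfolding g_def by (rule rep_abs_L1) simp
  have gU: "g n \<in> L1_on U" for n
    using g[of n] f unfolding L1_on_def mem_Collect_eq by eventually_elim (auto simp: c_def)
  have gL2: "L2_fun U (rep_L1 (g n))" for n
    unfolding L2_fun_def
  proof
    show m: "rep_L1 (g n) \<in> borel_measurable (lebesgue_on U)"
      by (rule measurable_restrict_space1[OF rep_L1_measurable])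
    have "integrable (lebesgue_on U) (rep_L1 f)"
      using U' integrable_mult_indicator[OF U' integrable_rep_L1[of f]]
      by (simp add: integrable_restrict_space)
    then have "integrable (lebesgue_on U) (\<lambda>x. real n * rep_L1 f x)" by simp
    then show "integrable (lebesgue_on U) (\<lambda>x. (norm (rep_L1 (g n) x))\<^sup>2)"
    proof (rule Bochner_Integration.integrable_bound)
      have "AE x in lebesgue_on U. rep_L1 (g n) x = c n x"
        using g[of n] U' by (auto simp: AE_restrict_space_iff elim: eventually_mono)
      then show "AE x in lebesgue_on U. norm ((norm (rep_L1 (g n) x))\<^sup>2) \<le> norm (real n * rep_L1 f x)"
      proof eventually_elim
        case (elim x)
        have "\<bar>c n x\<bar> \<le> real n" "\<bar>c n x\<bar> \<le> \<bar>rep_L1 f x\<bar>" by (auto simp: c_def)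
        then have "\<bar>c n x\<bar> * \<bar>c n x\<bar> \<le> real n * \<bar>rep_L1 f x\<bar>" by (intro mult_mono) auto
        then show ?case using elim by (simp add: power2_eq_square abs_mult)
      qed
    qed (use m in simp)
  qed
  have "(\<lambda>n. LINT x|lebesgue. \<bar>c n x - rep_L1 f x\<bar>) \<longlonglongrightarrow> (LINT x|(lebesgue :: 'a measure). 0)"
  proof (rule integral_dominated_convergence[where w = "\<lambda>x. \<bar>rep_L1 f x\<bar>"])
    have "(\<lambda>n. \<bar>c n x - rep_L1 f x\<bar>) \<longlonglongrightarrow> 0" for x
    proof (rule tendsto_eventually)
      obtain N where N: "\<bar>rep_L1 f x\<bar> \<le> real N" using real_arch_simple by blast
      show "\<forall>\<^sub>F n in sequentially. \<bar>c n x - rep_L1 f x\<bar> = 0"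
        using eventually_ge_at_top[of N]
        by eventually_elim (use N in \<open>auto simp: c_def\<close>)
    qed
    then show "AE x in lebesgue. (\<lambda>n. \<bar>c n x - rep_L1 f x\<bar>) \<longlonglongrightarrow> 0" by simp
    show "AE x in lebesgue. norm \<bar>c n x - rep_L1 f x\<bar> \<le> \<bar>rep_L1 f x\<bar>" for n
      by (rule AE_I2) (auto simp: c_def)
  qed (use borel_measurable_integrable[OF c] in auto)
  moreover have "dist (g n) f = (LINT x|lebesgue. \<bar>c n x - rep_L1 f x\<bar>)" for n
    unfolding dist_L1_eq
    by (rule integral_cong_AE) (use g[of n] borel_measurable_integrable[OF c] in auto)
  ultimately have g_lim: "g \<longlonglongrightarrow> f" by (subst tendsto_dist_iff) simp
  have id: "restrict_L1 U f = f" "\<And>n. restrict_L1 U (g n) = g n"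
    using f gU U' by (auto simp: in_L1_on_iff)
  have "(\<lambda>n. S t (restrict_L1 U (g n))) \<longlonglongrightarrow> S t (restrict_L1 U f)"
    using S U' t g_lim unfolding heat_semigroup_def
    by (blast intro: bounded_linear.tendsto[OF bounded_linear_semigroup_restrict])
  then have "(\<lambda>n. neg_L1 (S t (g n))) \<longlonglongrightarrow> neg_L1 (S t f)"
    unfolding id by (rule tendsto_neg_L1)
  moreover have "(\<lambda>n. neg_L1 (g n)) \<longlonglongrightarrow> neg_L1 f" by (rule tendsto_neg_L1[OF g_lim])
  ultimately show ?thesis
    by (rule LIMSEQ_le) (use neg_heat_L2[OF S U gU gL2 t] in auto)
qed

section \<open>The nonlocal operators\<close>

lemma borel_measurable_lebesgue_AE:
  fixes f g :: "'a::euclidean_space \<Rightarrow> real"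
  assumes g: "g \<in> borel_measurable lebesgue" and eq: "AE x in lebesgue. f x = g x"
  shows "f \<in> borel_measurable lebesgue"
proof (rule measurableI)
  fix B :: "real set" assume B: "B \<in> sets borel"
  show "f -` B \<inter> space lebesgue \<in> sets lebesgue"
    by (rule completion.in_sets_AE[OF _ measurable_sets[OF g B]]) (use eq in \<open>auto elim!: eventually_mono\<close>)
qed simp

lemma AE_lebesgue_iff_negligible: "(AE x in lebesgue. P x) \<longleftrightarrow> negligible {x. \<not> P x}"
  by (simp add: completion.AE_iff_null_sets negligible_iff_null_sets)

text \<open>Reflections are differentiable and so preserve null sets. For each fixed
  \<open>x\<close> this allows the kernel to be replaced by a Borel version inside
  \<open>J (x - y)\<close>.\<close>

lemma AE_lebesgue_reflect:
  fixes x :: "'a::euclidean_space"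
  assumes "AE z in lebesgue. P z"
  shows "AE y in lebesgue. P (x - y)"
proof -
  have "negligible ((\<lambda>z. x - z) ` {z. \<not> P z})"
    using assms
    by (intro negligible_differentiable_image_negligible)
      (auto simp: AE_lebesgue_iff_negligible intro!: derivative_intros)
  moreover have "{y. \<not> P (x - y)} \<subseteq> (\<lambda>z. x - z) ` {z. \<not> P z}"
    by (auto simp: image_iff intro!: exI[of _ "x - _"])
  ultimately show ?thesis
    unfolding AE_lebesgue_iff_negligible by (rule negligible_subset)
qed

lemma lborel_distr_reflect: "distr lborel borel (\<lambda>y. x - y) = (lborel :: 'a::euclidean_space measure)"
  using lborel_affine[of "- 1" x] by (simp add: density_1)

lemma
  fixes f :: "'a::euclidean_space \<Rightarrow> real"
  assumes f: "integrable lborel f"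
  shows integrable_reflect: "integrable lborel (\<lambda>y. f (x - y))"
    and integral_reflect: "(LINT y|lborel. f (x - y)) = (LINT y|lborel. f y)"
  using f integrable_distr_eq[of "\<lambda>y. x - y" lborel borel f] integral_distr[of "\<lambda>y. x - y" lborel borel f]
  unfolding lborel_distr_reflect by auto

lemma
  fixes f :: "'a::euclidean_space \<Rightarrow> real"
  assumes f: "integrable lborel f"
  shows integrable_translate: "integrable lborel (\<lambda>x. f (x - y))"
    and integral_translate: "(LINT x|lborel. f (x - y)) = (LINT x|lborel. f x)"
  using f integrable_distr_eq[of "\<lambda>x. - y + x" lborel borel f] integral_distr[of "\<lambda>x. - y + x" lborel borel f]
  unfolding lborel_distr_plus by auto

text \<open>Fubini's theorem will be applied to functions of \<open>x - y\<close> and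
  \<open>y\<close>, whose joint measurability is immediate for Borel functions on the product of
  \<open>lborel\<close> with itself.\<close>

lemma integrable_lebesgue_borel_version:
  fixes f :: "'a::euclidean_space \<Rightarrow> real"
  assumes f: "integrable lebesgue f"
  obtains g where "g \<in> borel_measurable borel" "AE x in lebesgue. f x = g x" "integrable lborel g"
    "(LINT x|lborel. g x) = (LINT x|lebesgue. f x)"
proof -
  obtain g where g: "g \<in> borel_measurable lborel" and eq: "AE x in lborel. f x = g x"
    using completion_ex_borel_measurable_real[OF borel_measurable_integrable[OF f]] by blast
  have eq': "AE x in lebesgue. f x = g x" using eq by (rule AE_completion)
  have "integrable lebesgue g"
    using f integrable_cong_AE[of f lebesgue g] borel_measurable_integrable[OF f] g eq'
    by (simp add: measurable_completion)
  then have "integrable lborel g" using g by (simp add: integrable_completion)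
  moreover have "(LINT x|lborel. g x) = (LINT x|lebesgue. f x)"
    using integral_cong_AE[of f lebesgue g] borel_measurable_integrable[OF f] g eq'
    by (simp add: measurable_completion integral_completion)
  ultimately show ?thesis using that g eq' by simp
qed

section \<open>Gain and loss terms of a probability kernel\<close>

locale probability_kernel =
  fixes J :: "'a::euclidean_space \<Rightarrow> real"
  assumes nonneg: "\<And>x. J x \<ge> 0" and has_integral_1: "has_bochner_integral lebesgue J 1"
begin

lemma borel_version:
  obtains J' where "J' \<in> borel_measurable borel" "AE x in lebesgue. J x = J' x" "integrable lborel J'"
    "(LINT x|lborel. J' x) = 1" "\<And>x. J' x \<ge> 0"
proof -
  have "integrable lebesgue J" "(LINT x|lebesgue. J x) = 1"
    using has_integral_1 by (auto simp: has_bochner_integral_iff)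
  then obtain g where g: "g \<in> borel_measurable borel" "AE x in lebesgue. J x = g x" "integrable lborel g"
    "(LINT x|lborel. g x) = 1"
    by (metis integrable_lebesgue_borel_version)
  have ae: "AE x in lborel. g x = \<bar>g x\<bar>"
    using g(2) unfolding AE_completion_iff by eventually_elim (use nonneg in \<open>metis abs_of_nonneg\<close>)
  \<comment> \<open>The absolute value makes the version nonnegative everywhere and changes it only
    on a null set, as \<open>J\<close> is nonnegative.\<close>
  show ?thesis
  proof (rule that[of "\<lambda>x. \<bar>g x\<bar>"])
    show "(\<lambda>x. \<bar>g x\<bar>) \<in> borel_measurable borel" using g(1) by simp
    show "AE x in lebesgue. J x = \<bar>g x\<bar>"
      using g(2) by eventually_elim (use nonneg in \<open>metis abs_of_nonneg\<close>)
    show "integrable lborel (\<lambda>x. \<bar>g x\<bar>)" using g(3) by simp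
    show "(LINT x|lborel. \<bar>g x\<bar>) = 1"
      using integral_cong_AE[OF _ _ ae] g(1,4) by simp
  qed simp
qed

text \<open>The integral is the coefficient of \<open>u x\<close> in the loss term. Reflection
  invariance of Lebesgue measure bounds it by the total mass of the kernel at every
  \<open>x\<close>.\<close>

lemma
  assumes C: "C \<in> sets borel"
  shows kernel_integrable: "integrable lebesgue (\<lambda>y. indicator C y * J (x - y))"
    and kernel_mass_le_1: "(LINT y|lebesgue. indicator C y * J (x - y)) \<le> 1"
    and kernel_mass_measurable: "(\<lambda>x. LINT y|lebesgue. indicator C y * J (x - y)) \<in> borel_measurable lebesgue"
proof -
  obtain J' where J': "J' \<in> borel_measurable borel" "AE x in lebesgue. J x = J' x" "integrable lborel J'"
    "(LINT x|lborel. J' x) = 1" "\<And>x. J' x \<ge> 0" using borel_version by metis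
  note [measurable] = C J'(1)
  have ae: "AE y in lebesgue. indicator C y * J (x - y) = indicator C y * J' (x - y)" for x
    using AE_lebesgue_reflect[OF J'(2), of x] by eventually_elim simp
  have i: "integrable lborel (\<lambda>y. indicator C y * J' (x - y))" for x
    by (rule Bochner_Integration.integrable_bound[OF integrable_reflect[OF J'(3), of x]])
      (auto simp: indicator_def)
  then have i': "integrable lebesgue (\<lambda>y. indicator C y * J' (x - y))" for x
    by (subst integrable_completion) auto
  have m: "(\<lambda>y. indicator C y * J (x - y)) \<in> borel_measurable lebesgue" for x
    by (rule borel_measurable_lebesgue_AE[OF borel_measurable_integrable[OF i'] ae])
  show "integrable lebesgue (\<lambda>y. indicator C y * J (x - y))"
    using integrable_cong_AE[OF m borel_measurable_integrable[OF i'] ae] i' by blast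
  have eq: "(LINT y|lebesgue. indicator C y * J (x - y)) = (LINT y|lborel. indicator C y * J' (x - y))" for x
  proof -
    have "(LINT y|lebesgue. indicator C y * J (x - y)) = (LINT y|lebesgue. indicator C y * J' (x - y))"
      by (rule integral_cong_AE[OF m borel_measurable_integrable[OF i'] ae])
    also have "\<dots> = (LINT y|lborel. indicator C y * J' (x - y))"
      by (rule integral_completion) simp
    finally show ?thesis .
  qed
  have "(LINT y|lborel. indicator C y * J' (x - y)) \<le> (LINT y|lborel. J' (x - y))"
    by (rule integral_mono[OF i integrable_reflect[OF J'(3)]]) (use J'(5) in \<open>auto simp: indicator_def\<close>)
  then show "(LINT y|lebesgue. indicator C y * J (x - y)) \<le> 1"
    unfolding eq using J'(4) by (simp add: integral_reflect[OF J'(3)])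
  show "(\<lambda>x. LINT y|lebesgue. indicator C y * J (x - y)) \<in> borel_measurable lebesgue"
    unfolding eq by (rule measurable_completion) simp
qed

lemma kernel_mass_nonneg: "(LINT y|lebesgue. indicator C y * J (x - y)) \<ge> 0"
  by (rule Bochner_Integration.integral_nonneg) (simp add: nonneg)

text \<open>Fubini's theorem for the Borel version \<open>h\<close> of the integrand. Convergence of
  the gain integral for almost every \<open>x\<close> and its integrability both come from
  integrability of \<open>h\<close> on the product space.\<close>

lemma
  assumes C: "C \<in> sets borel" and f: "integrable lebesgue f"
  shows smoothing_AE_integrable:
      "AE x in lebesgue. integrable lebesgue (\<lambda>y. indicator C y * J (x - y) * f y)"
    and smoothing_integrable:
      "integrable lebesgue (\<lambda>x. LINT y|lebesgue. indicator C y * J (x - y) * f y)"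
    and smoothing_integral_le:
      "(\<And>x. f x \<ge> 0) \<Longrightarrow>
        (LINT x|lebesgue. LINT y|lebesgue. indicator C y * J (x - y) * f y) \<le> (LINT x|lebesgue. f x)"
proof -
  obtain J' where J': "J' \<in> borel_measurable borel" "AE x in lebesgue. J x = J' x" "integrable lborel J'"
    "(LINT x|lborel. J' x) = 1" "\<And>x. J' x \<ge> 0" using borel_version by metis
  obtain f' where f': "f' \<in> borel_measurable borel" "AE x in lebesgue. f x = f' x" "integrable lborel f'"
    "(LINT x|lborel. f' x) = (LINT x|lebesgue. f x)"
    by (rule integrable_lebesgue_borel_version[OF f])
  note [measurable] = C J'(1) f'(1)
  define h where "h y x = indicator C y * J' (x - y) * f' y" for y x
  have h_meas: "case_prod h \<in> borel_measurable (lborel \<Otimes>\<^sub>M lborel)"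
    unfolding h_def by measurable
  have slice: "integrable lborel (h y)" for y
    unfolding h_def[abs_def] using integrable_translate[OF J'(3), of y]
    by (intro Bochner_Integration.integrable_mult_left integrable_mult_right)
  \<comment> \<open>Integration in \<open>x\<close> comes first, since by translation invariance the
    kernel then contributes exactly its mass 1.\<close>
  have "(LINT x|lborel. norm (h y x)) = indicator C y * \<bar>f' y\<bar>" for y
    using integral_translate[OF J'(3), of y] J'(4,5)
    by (simp add: h_def abs_mult)
  moreover have "integrable lborel (\<lambda>y. indicator C y * \<bar>f' y\<bar>)"
    using f'(3) by (intro Bochner_Integration.integrable_bound[OF f'(3)]) (auto simp: indicator_def)
  ultimately have h: "integrable (lborel \<Otimes>\<^sub>M lborel) (case_prod h)"
    using slice by (intro lborel_pair.Fubini_integrable[OF h_meas]) auto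
  have ae: "AE y in lebesgue. indicator C y * J (x - y) * f y = h y x" for x
    using AE_lebesgue_reflect[OF J'(2), of x] f'(2) by eventually_elim (simp add: h_def)
  have h_x: "(\<lambda>y. h y x) \<in> borel_measurable borel" for x unfolding h_def by measurable
  then have h_x': "(\<lambda>y. h y x) \<in> borel_measurable lebesgue" for x
    by (intro measurable_completion) simp
  have m: "(\<lambda>y. indicator C y * J (x - y) * f y) \<in> borel_measurable lebesgue" for x
    by (rule borel_measurable_lebesgue_AE[OF h_x' ae])
  have iff: "integrable lebesgue (\<lambda>y. indicator C y * J (x - y) * f y) \<longleftrightarrow> integrable lborel (\<lambda>y. h y x)" for x
    using integrable_cong_AE[OF m h_x' ae] h_x by (simp add: integrable_completion)
  have eq: "(LINT y|lebesgue. indicator C y * J (x - y) * f y) = (LINT y|lborel. h y x)" for x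
    using integral_cong_AE[OF m h_x' ae] h_x by (simp add: integral_completion)
  show "AE x in lebesgue. integrable lebesgue (\<lambda>y. indicator C y * J (x - y) * f y)"
    unfolding iff AE_completion_iff using lborel_pair.AE_integrable_snd[OF h] .
  have int: "integrable lborel (\<lambda>x. LINT y|lborel. h y x)"
    using lborel_pair.integrable_snd[OF h] .
  then show "integrable lebesgue (\<lambda>x. LINT y|lebesgue. indicator C y * J (x - y) * f y)"
    unfolding eq by (subst integrable_completion) auto
  assume f0: "\<And>x. f x \<ge> 0"
  have "(LINT x|lebesgue. LINT y|lebesgue. indicator C y * J (x - y) * f y)
      = (LINT x|lborel. LINT y|lborel. h y x)"
    unfolding eq using int by (intro integral_completion) auto
  also have "\<dots> = (LINT y|lborel. LINT x|lborel. h y x)"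
    by (rule lborel_pair.Fubini_integral[OF h])
  also have "\<dots> = (LINT y|lborel. indicator C y * f' y)"
    using integral_translate[OF J'(3)] J'(4) by (simp add: h_def)
  also have "\<dots> \<le> (LINT y|lborel. f' y)"
  proof (rule integral_mono_AE)
    show "integrable lborel (\<lambda>y. indicator C y * f' y)"
      by (intro Bochner_Integration.integrable_bound[OF f'(3)]) (auto simp: indicator_def)
    show "AE y in lborel. indicator C y * f' y \<le> f' y"
      using f'(2) unfolding AE_completion_iff
      by eventually_elim (use f0 in \<open>metis indicator_le_1 mult_left_le_one_le indicator_pos_le\<close>)
  qed (rule f'(3))
  finally show "(LINT x|lebesgue. LINT y|lebesgue. indicator C y * J (x - y) * f y) \<le> (LINT x|lebesgue. f x)"
    using f'(4) by simp
qed

text \<open>Splitting into gain and loss is legitimate wherever the gain integral converges, which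
  is the case for almost every \<open>x\<close>.\<close>

lemma nonlocal_term_eq:
  assumes C: "C \<in> sets borel" and f: "integrable lebesgue f"
  shows "AE x in lebesgue. nonlocal_term J C f x =
    (LINT y|lebesgue. indicator C y * J (x - y) * f y)
    - (LINT y|lebesgue. indicator C y * J (x - y)) * f x"
  using smoothing_AE_integrable[OF assms]
proof eventually_elim
  case (elim x)
  have "nonlocal_term J C f x
      = (LINT y|lebesgue. indicator C y * J (x - y) * f y - indicator C y * J (x - y) * f x)"
    unfolding nonlocal_term_def set_lebesgue_integral_def
    by (rule Bochner_Integration.integral_cong) (auto simp: algebra_simps)
  also have "\<dots> = (LINT y|lebesgue. indicator C y * J (x - y) * f y)
      - (LINT y|lebesgue. indicator C y * J (x - y)) * f x"
    using elim kernel_integrable[OF C, of x] by simp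
  finally show ?case .
qed

lemma nonlocal_term_integrable:
  assumes A: "A \<in> sets lebesgue" and C: "C \<in> sets borel" and f: "integrable lebesgue f"
  shows "integrable lebesgue (\<lambda>x. indicator A x * nonlocal_term J C f x)"
proof -
  define g where "g x = (LINT y|lebesgue. indicator C y * J (x - y) * f y)
    - (LINT y|lebesgue. indicator C y * J (x - y)) * f x" for x
  have "integrable lebesgue (\<lambda>x. (LINT y|lebesgue. indicator C y * J (x - y)) * f x)"
  proof (rule Bochner_Integration.integrable_bound[OF f])
    show "(\<lambda>x. (LINT y|lebesgue. indicator C y * J (x - y)) * f x) \<in> borel_measurable lebesgue"
      using kernel_mass_measurable[OF C] borel_measurable_integrable[OF f] by (rule borel_measurable_times)
    show "AE x in lebesgue. norm ((LINT y|lebesgue. indicator C y * J (x - y)) * f x) \<le> norm (f x)"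
      using kernel_mass_nonneg[of C] kernel_mass_le_1[OF C] by (auto simp: abs_mult intro!: mult_left_le_one_le)
  qed
  then have "integrable lebesgue g"
    unfolding g_def using smoothing_integrable[OF C f] by simp
  from integrable_mult_indicator[OF A this]
  have g: "integrable lebesgue (\<lambda>x. indicator A x * g x)" by simp
  have ae: "AE x in lebesgue. indicator A x * nonlocal_term J C f x = indicator A x * g x"
    using nonlocal_term_eq[OF C f] unfolding g_def by eventually_elim simp
  show ?thesis
    using integrable_cong_AE[OF borel_measurable_lebesgue_AE[OF borel_measurable_integrable[OF g] ae]
        borel_measurable_integrable[OF g] ae] g by blast
qed

section \<open>Nonlocal operators on classes of functions\<close>

definition nonlocal_L1 :: "'a set \<Rightarrow> 'a set \<Rightarrow> 'a L1 \<Rightarrow> 'a L1"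
  where "nonlocal_L1 A C u = abs_L1 (\<lambda>x. indicator A x * nonlocal_term J C (rep_L1 u) x)"

lemma rep_nonlocal_L1:
  assumes A: "A \<in> sets lebesgue" and C: "C \<in> sets borel"
  shows "AE x in lebesgue. rep_L1 (nonlocal_L1 A C u) x = indicator A x *
    ((LINT y|lebesgue. indicator C y * J (x - y) * rep_L1 u y)
    - (LINT y|lebesgue. indicator C y * J (x - y)) * rep_L1 u x)"
  using rep_abs_L1[OF nonlocal_term_integrable[OF A C integrable_rep_L1[of u]]]
    nonlocal_term_eq[OF C integrable_rep_L1[of u]]
  unfolding nonlocal_L1_def by eventually_elim simp

lemma smoothing_cong:
  assumes C: "C \<in> sets borel" and f: "integrable lebesgue f" and g: "integrable lebesgue g"
    and eq: "AE y in lebesgue. f y = g y"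
  shows "AE x in lebesgue. (LINT y|lebesgue. indicator C y * J (x - y) * f y)
    = (LINT y|lebesgue. indicator C y * J (x - y) * g y)"
  using smoothing_AE_integrable[OF C f] smoothing_AE_integrable[OF C g]
proof eventually_elim
  case (elim x)
  show ?case
    by (rule integral_cong_AE) (use elim eq in \<open>auto elim!: eventually_mono\<close>)
qed

lemma nonlocal_L1_add:
  assumes A: "A \<in> sets lebesgue" and C: "C \<in> sets borel"
  shows "nonlocal_L1 A C (u + v) = nonlocal_L1 A C u + nonlocal_L1 A C v"
proof (rule L1_eqI)
  have i: "integrable lebesgue (\<lambda>x. rep_L1 u x + rep_L1 v x)" by simp
  show "AE x in lebesgue. rep_L1 (nonlocal_L1 A C (u + v)) x = rep_L1 (nonlocal_L1 A C u + nonlocal_L1 A C v) x"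
    using rep_nonlocal_L1[OF A C, of u] rep_nonlocal_L1[OF A C, of v] rep_nonlocal_L1[OF A C, of "u + v"]
      rep_plus_L1[of "nonlocal_L1 A C u" "nonlocal_L1 A C v"] rep_plus_L1[of u v]
      smoothing_cong[OF C integrable_rep_L1 i rep_plus_L1]
      smoothing_AE_integrable[OF C integrable_rep_L1[of u]]
      smoothing_AE_integrable[OF C integrable_rep_L1[of v]]
    by eventually_elim (simp add: distrib_left right_diff_distrib)
qed

lemma nonlocal_L1_scaleR:
  assumes A: "A \<in> sets lebesgue" and C: "C \<in> sets borel"
  shows "nonlocal_L1 A C (c *\<^sub>R u) = c *\<^sub>R nonlocal_L1 A C u"
proof (rule L1_eqI)
  have i: "integrable lebesgue (\<lambda>x. c * rep_L1 u x)" by simp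
  have pull: "(LINT y|lebesgue. indicator C y * J (x - y) * (c * rep_L1 u y))
      = c * (LINT y|lebesgue. indicator C y * J (x - y) * rep_L1 u y)" for x
    by (subst integral_mult_right_zero[symmetric]) (simp add: mult_ac)
  show "AE x in lebesgue. rep_L1 (nonlocal_L1 A C (c *\<^sub>R u)) x = rep_L1 (c *\<^sub>R nonlocal_L1 A C u) x"
    using rep_nonlocal_L1[OF A C, of u] rep_nonlocal_L1[OF A C, of "c *\<^sub>R u"]
      rep_scaleR_L1[of c "nonlocal_L1 A C u"] rep_scaleR_L1[of c u]
      smoothing_cong[OF C integrable_rep_L1 i rep_scaleR_L1]
    unfolding pull
  proof eventually_elim
    case (elim x)
    show ?case
      unfolding elim(3) elim(2) elim(1) elim(4) elim(5) by (simp only: algebra_simps)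
  qed
qed

text \<open>Adding the identity makes the operator positive, since the loss term has total rate at most 1.\<close>

lemma neg_nonlocal_L1_shift:
  assumes A: "A \<in> sets lebesgue" and C: "C \<in> sets borel"
  shows "neg_L1 (nonlocal_L1 A C u + u) \<le> 2 * neg_L1 u"
proof -
  define n where "n x = max 0 (- rep_L1 u x)" for x
  define G where "G x = (LINT y|lebesgue. indicator C y * J (x - y) * n y)" for x
  have n: "integrable lebesgue n" unfolding n_def by simp
  note G = smoothing_integrable[OF C n, folded G_def]
  \<comment> \<open>\<open>G\<close> bounds the negative part coming from the gain term,
    \<open>n\<close> the one coming from the remaining multiple of \<open>u x\<close>. Each has
    integral at most \<open>neg_L1 u\<close>, whence the factor 2.\<close>
  have "neg_L1 (nonlocal_L1 A C u + u) \<le> (LINT x|lebesgue. G x + n x)"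
    unfolding neg_L1_eq
  proof (rule integral_mono_AE)
    show "AE x in lebesgue. max 0 (- rep_L1 (nonlocal_L1 A C u + u) x) \<le> G x + n x"
      using rep_nonlocal_L1[OF A C, of u] rep_plus_L1[of "nonlocal_L1 A C u" u]
        smoothing_AE_integrable[OF C integrable_rep_L1[of u]] smoothing_AE_integrable[OF C n]
    proof eventually_elim
      case (elim x)
      define g where "g = (LINT y|lebesgue. indicator C y * J (x - y) * rep_L1 u y)"
      define m where "m = (LINT y|lebesgue. indicator C y * J (x - y))"
      have "0 \<le> (LINT y|lebesgue. indicator C y * J (x - y) * rep_L1 u y + indicator C y * J (x - y) * n y)"
        by (rule Bochner_Integration.integral_nonneg)
          (auto simp: n_def nonneg simp flip: distrib_left)
      then have gG: "- g \<le> G x" unfolding g_def G_def using elim by simp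
      have G0: "G x \<ge> 0" unfolding G_def
        by (rule Bochner_Integration.integral_nonneg) (simp add: n_def nonneg)
      have m: "0 \<le> m" "m \<le> 1"
        unfolding m_def by (rule kernel_mass_nonneg, rule kernel_mass_le_1[OF C])
      \<comment> \<open>Identity and loss together multiply \<open>u x\<close> by
        \<open>1 - indicator A x * m\<close>, which lies between 0 and 1.\<close>
      have r: "(1 - indicator A x * m) * - rep_L1 u x \<le> n x"
      proof -
        have i: "0 \<le> 1 - indicator A x * m" "1 - indicator A x * m \<le> 1" using m by (auto simp: indicator_def)
        have "(1 - indicator A x * m) * - rep_L1 u x \<le> (1 - indicator A x * m) * n x"
          using i by (intro mult_left_mono) (auto simp: n_def)
        also have "\<dots> \<le> n x" using i by (intro mult_left_le_one_le) (auto simp: n_def)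
        finally show ?thesis .
      qed
      have "indicator A x * - g \<le> G x" using gG G0 by (auto simp: indicator_def)
      moreover have "rep_L1 (nonlocal_L1 A C u + u) x = indicator A x * (g - m * rep_L1 u x) + rep_L1 u x"
        unfolding elim(2) elim(1) g_def m_def ..
      ultimately have "- rep_L1 (nonlocal_L1 A C u + u) x \<le> G x + n x"
        using r by (simp add: algebra_simps)
      moreover have "0 \<le> G x + n x" using G0 by (simp add: n_def)
      ultimately show ?case by simp
    qed
  qed (use G n in auto)
  also have "\<dots> = (LINT x|lebesgue. G x) + (LINT x|lebesgue. n x)" using G n by simp
  also have "\<dots> \<le> 2 * (LINT x|lebesgue. n x)"
    using smoothing_integral_le[OF C n] by (simp add: n_def G_def)
  also have "(LINT x|lebesgue. n x) = neg_L1 u" by (simp add: neg_L1_eq n_def)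
  finally show ?thesis .
qed

text \<open>The positivity estimate for \<open>u\<close> and \<open>- u\<close> bounds the shifted
  operator by 2, and removing the identity adds 1.\<close>

lemma bounded_linear_nonlocal_L1:
  assumes A: "A \<in> sets lebesgue" and C: "C \<in> sets borel"
  shows "bounded_linear (nonlocal_L1 A C)"
proof (rule bounded_linear_intro[of _ 3])
  show "norm (nonlocal_L1 A C u) \<le> norm u * 3" for u
  proof -
    have "- (nonlocal_L1 A C u + u) = nonlocal_L1 A C (- u) + - u"
      using nonlocal_L1_scaleR[OF A C, of "- 1" u] by simp
    then have "norm (nonlocal_L1 A C u + u) \<le> 2 * norm u"
      using neg_nonlocal_L1_shift[OF A C, of u] neg_nonlocal_L1_shift[OF A C, of "- u"]
      unfolding norm_eq_neg_L1[of "nonlocal_L1 A C u + u"] norm_eq_neg_L1[of u] by simp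
    then show ?thesis
      using norm_triangle_ineq4[of "nonlocal_L1 A C u + u" u] by simp
  qed
qed (simp_all add: nonlocal_L1_add[OF A C] nonlocal_L1_scaleR[OF A C])

lemma local_region_source_eq:
  assumes "A \<in> sets borel"
  shows "local_region_source J \<alpha> A u = \<alpha> *\<^sub>R nonlocal_L1 A (- A) u"
proof -
  have "A \<in> sets lebesgue" "- A \<in> sets borel" using assms by auto
  then show ?thesis
    unfolding local_region_source_def nonlocal_L1_def
    by (subst abs_L1_scaleR[OF nonlocal_term_integrable]) (auto simp: mult.left_commute)
qed

lemma nonlocal_region_rhs_eq:
  assumes "A \<in> sets borel"
  shows "nonlocal_region_rhs J \<alpha> A u = \<alpha> *\<^sub>R nonlocal_L1 A (- A) u + (2 * \<alpha>) *\<^sub>R nonlocal_L1 A A u"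
proof -
  have A: "A \<in> sets lebesgue" "- A \<in> sets borel" using assms by auto
  note i = nonlocal_term_integrable[OF A integrable_rep_L1[of u]]
    nonlocal_term_integrable[OF A(1) assms integrable_rep_L1[of u]]
  have i': "integrable lebesgue (\<lambda>x. \<alpha> * (indicator A x * nonlocal_term J (- A) (rep_L1 u) x))"
    "integrable lebesgue (\<lambda>x. 2 * \<alpha> * (indicator A x * nonlocal_term J A (rep_L1 u) x))"
    by (intro integrable_mult_right i)+
  show ?thesis
    unfolding nonlocal_region_rhs_def nonlocal_L1_def abs_L1_scaleR[OF i(1)] abs_L1_scaleR[OF i(2)]
      abs_L1_plus[OF i'] by (simp add: algebra_simps)
qed

lemma nonlocal_L1_in_L1_on:
  assumes A: "A \<in> sets lebesgue" and C: "C \<in> sets borel"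
  shows "nonlocal_L1 A C u \<in> L1_on A"
  unfolding L1_on_def mem_Collect_eq
  using rep_nonlocal_L1[OF A C, of u] by eventually_elim simp

end

section \<open>The coupled problem\<close>

lemma L1_on_mono: "A \<subseteq> B \<Longrightarrow> L1_on A \<subseteq> L1_on B"
  unfolding L1_on_def by (auto elim!: eventually_mono)

lemma
  assumes A: "A \<in> sets lebesgue" and u: "u \<in> L1_on A" and v: "v \<in> L1_on A"
  shows L1_on_add: "u + v \<in> L1_on A" and L1_on_diff: "u - v \<in> L1_on A"
proof -
  interpret bounded_linear "restrict_L1 A" by (rule bounded_linear_restrict_L1[OF A])
  show "u + v \<in> L1_on A" "u - v \<in> L1_on A"
    using u v by (simp_all add: in_L1_on_iff[OF A] add diff)
qed

lemma restrict_in_L1_on: "A \<in> sets lebesgue \<Longrightarrow> restrict_L1 A u \<in> L1_on A"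
  by (simp add: in_L1_on_iff restrict_restrict_L1)

lemma restrict_L1_on_disjoint:
  assumes "A \<in> sets lebesgue" "B \<in> sets lebesgue" "A \<inter> B = {}" "u \<in> L1_on B"
  shows "restrict_L1 A u = 0"
  using assms restrict_restrict_L1[of A B u] by (simp add: in_L1_on_iff restrict_L1_empty)

text \<open>Restricting before \<open>S\<close> acts makes the definition independent of the values
  of \<open>S\<close> outside \<open>L1_on U\<close>.\<close>

definition extend_semigroup ::
  "'a::euclidean_space set \<Rightarrow> (real \<Rightarrow> 'a L1 \<Rightarrow> 'a L1) \<Rightarrow> real \<Rightarrow> 'a L1 \<Rightarrow> 'a L1"
  where "extend_semigroup U S t f = S t (restrict_L1 U f) + (f - restrict_L1 U f)"

context
  fixes U D :: "'a::euclidean_space set" and S :: "real \<Rightarrow> 'a L1 \<Rightarrow> 'a L1"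
  assumes S: "heat_semigroup U D S" and U: "U \<in> lmeasurable"
begin

lemma heat_domain_measurable: "U \<in> sets lebesgue" using U by (rule fmeasurableD)

interpretation P: bounded_linear "restrict_L1 U" by (rule bounded_linear_restrict_L1[OF heat_domain_measurable])

lemma heat_semigroup_C0: "C0_semigroup (L1_on U) S" using S by (simp add: heat_semigroup_def)

lemma heat_in_L1_on: "t \<ge> 0 \<Longrightarrow> f \<in> L1_on U \<Longrightarrow> S t f \<in> L1_on U"
  using heat_semigroup_C0 unfolding C0_semigroup_def by blast

lemma restrict_extend_semigroup:
  assumes "t \<ge> 0"
  shows "restrict_L1 U (extend_semigroup U S t f) = S t (restrict_L1 U f)"
  using heat_in_L1_on[OF assms restrict_in_L1_on[OF heat_domain_measurable, of f]] heat_domain_measurable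
  by (simp add: extend_semigroup_def P.add P.diff restrict_restrict_L1 in_L1_on_iff)

lemma neg_extend_semigroup:
  assumes t: "t \<ge> 0"
  shows "neg_L1 (extend_semigroup U S t f) \<le> neg_L1 f"
proof -
  have "neg_L1 (extend_semigroup U S t f) \<le> neg_L1 (S t (restrict_L1 U f)) + neg_L1 (f - restrict_L1 U f)"
    unfolding extend_semigroup_def by (rule neg_L1_add_le)
  also have "\<dots> \<le> neg_L1 (restrict_L1 U f) + neg_L1 (f - restrict_L1 U f)"
    using neg_heat[OF S U t restrict_in_L1_on[OF heat_domain_measurable]] by simp
  also have "\<dots> = neg_L1 f" by (rule neg_restrict_L1_add[OF heat_domain_measurable])
  finally show ?thesis .
qed

lemma contraction_extend_semigroup: "contraction_semigroup (extend_semigroup U S)"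
proof (rule contraction_semigroup.intro)
  show lin: "linear (extend_semigroup U S t)" if "t \<ge> 0" for t
    unfolding extend_semigroup_def
    by (intro bounded_linear.linear bounded_linear_add bounded_linear_sub bounded_linear_ident
        bounded_linear_semigroup_restrict[OF heat_semigroup_C0 heat_domain_measurable that] P.bounded_linear_axioms)
  show "norm (extend_semigroup U S t f) \<le> norm f" if t: "t \<ge> 0" for t f
    unfolding norm_eq_neg_L1[of f] norm_eq_neg_L1[of "extend_semigroup U S t f"]
    using neg_extend_semigroup[OF t, of f] neg_extend_semigroup[OF t, of "- f"]
    by (simp add: linear_neg[OF lin[OF t]])
  show "extend_semigroup U S 0 f = f" for f
    using heat_semigroup_C0 restrict_in_L1_on[OF heat_domain_measurable, of f] by (simp add: extend_semigroup_def C0_semigroup_def)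
  show "extend_semigroup U S (s + t) f = extend_semigroup U S s (extend_semigroup U S t f)"
    if "s \<ge> 0" "t \<ge> 0" for s t f
  proof -
    have "S (s + t) (restrict_L1 U f) = S s (S t (restrict_L1 U f))"
      using heat_semigroup_C0 restrict_in_L1_on[OF heat_domain_measurable, of f] that by (simp add: C0_semigroup_def)
    then show ?thesis
      using restrict_extend_semigroup[OF that(2), of f]
      by (simp add: extend_semigroup_def[of U S s] extend_semigroup_def[of U S "s + t"])
        (simp add: extend_semigroup_def)
  qed
  show "continuous_on {0..} (\<lambda>t. extend_semigroup U S t f)" for f
    using heat_semigroup_C0 restrict_in_L1_on[OF heat_domain_measurable, of f]
    unfolding extend_semigroup_def by (intro continuous_intros) (simp add: C0_semigroup_def)
qed

end

section \<open>The system as a single equation in L1\<close>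

locale local_nonlocal_problem =
  fixes J :: "'a::euclidean_space \<Rightarrow> real" and \<alpha> :: real
    and \<Omega> \<Omega>\<^sub>l \<Omega>\<^sub>n D :: "'a set" and S :: "real \<Rightarrow> 'a L1 \<Rightarrow> 'a L1"
  assumes J: "\<And>x. J x \<ge> 0" "has_bochner_integral lebesgue J 1"
    and alpha: "\<alpha> > 0"
    and sets: "open \<Omega>" "bounded \<Omega>" "open \<Omega>\<^sub>l" "open \<Omega>\<^sub>n" "\<Omega>\<^sub>l \<subseteq> \<Omega>" "\<Omega>\<^sub>n \<subseteq> \<Omega>" "\<Omega>\<^sub>l \<inter> \<Omega>\<^sub>n = {}"
    and interface: "negligible (\<Omega> - \<Omega>\<^sub>l - \<Omega>\<^sub>n)"
    and heat: "heat_semigroup \<Omega>\<^sub>l D S"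
begin

sublocale probability_kernel J by unfold_locales (rule J)+

lemma lmeasurable_local: "\<Omega>\<^sub>l \<in> lmeasurable"
  using sets bounded_subset[of \<Omega> \<Omega>\<^sub>l] by (simp add: lmeasurable_open)

lemma lebesgue_sets: "\<Omega> \<in> sets lebesgue" "\<Omega>\<^sub>l \<in> sets lebesgue" "\<Omega>\<^sub>n \<in> sets lebesgue"
  using sets by auto

lemma borel_sets: "\<Omega>\<^sub>l \<in> sets borel" "\<Omega>\<^sub>n \<in> sets borel" "- \<Omega>\<^sub>l \<in> sets borel" "- \<Omega>\<^sub>n \<in> sets borel"
  using sets by auto

abbreviation T :: "real \<Rightarrow> 'a L1 \<Rightarrow> 'a L1" where "T \<equiv> extend_semigroup \<Omega>\<^sub>l S"
abbreviation restrict_l :: "'a L1 \<Rightarrow> 'a L1" where "restrict_l \<equiv> restrict_L1 \<Omega>\<^sub>l"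
abbreviation restrict_n :: "'a L1 \<Rightarrow> 'a L1" where "restrict_n \<equiv> restrict_L1 \<Omega>\<^sub>n"
abbreviation source_l :: "'a L1 \<Rightarrow> 'a L1" where "source_l \<equiv> local_region_source J \<alpha> \<Omega>\<^sub>l"
abbreviation source_n :: "'a L1 \<Rightarrow> 'a L1" where "source_n \<equiv> nonlocal_region_rhs J \<alpha> \<Omega>\<^sub>n"

sublocale contraction_semigroup T
  by (rule contraction_extend_semigroup[OF heat lmeasurable_local])

sublocale restrict_l: bounded_linear restrict_l by (rule bounded_linear_restrict_L1[OF lebesgue_sets(2)])
sublocale restrict_n: bounded_linear restrict_n by (rule bounded_linear_restrict_L1[OF lebesgue_sets(3)])

definition B :: "'a L1 \<Rightarrow> 'a L1" where "B f = source_l f + source_n f"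

lemma B_eq: "B f = \<alpha> *\<^sub>R nonlocal_L1 \<Omega>\<^sub>l (- \<Omega>\<^sub>l) f
    + (\<alpha> *\<^sub>R nonlocal_L1 \<Omega>\<^sub>n (- \<Omega>\<^sub>n) f + (2 * \<alpha>) *\<^sub>R nonlocal_L1 \<Omega>\<^sub>n \<Omega>\<^sub>n f)"
  unfolding B_def local_region_source_eq[OF borel_sets(1)] nonlocal_region_rhs_eq[OF borel_sets(2)] ..

lemma bounded_linear_B: "bounded_linear B"
  unfolding B_eq
  by (intro bounded_linear_add bounded_linear_const_scaleR bounded_linear_nonlocal_L1 borel_sets lebesgue_sets)

text \<open>The three nonlocal operators in \<open>B\<close> carry the weights
  \<open>\<alpha>\<close>, \<open>\<alpha>\<close> and \<open>2 * \<alpha>\<close>, and each takes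
  one copy of the identity with its weight. This gives the shift \<open>4 * \<alpha>\<close>; the
  factor 2 of each operator then gives \<open>8 * \<alpha>\<close>.\<close>

lemma neg_B_shift: "neg_L1 (B f + (4 * \<alpha>) *\<^sub>R f) \<le> 8 * \<alpha> * neg_L1 f"
proof -
  let ?Q1 = "nonlocal_L1 \<Omega>\<^sub>l (- \<Omega>\<^sub>l) f + f" and ?Q2 = "nonlocal_L1 \<Omega>\<^sub>n (- \<Omega>\<^sub>n) f + f"
    and ?Q3 = "nonlocal_L1 \<Omega>\<^sub>n \<Omega>\<^sub>n f + f"
  have "B f + (4 * \<alpha>) *\<^sub>R f = \<alpha> *\<^sub>R ?Q1 + (\<alpha> *\<^sub>R ?Q2 + (2 * \<alpha>) *\<^sub>R ?Q3)"
    unfolding B_eq by (simp add: scaleR_add_right flip: scaleR_add_left)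
  then have "neg_L1 (B f + (4 * \<alpha>) *\<^sub>R f)
      \<le> neg_L1 (\<alpha> *\<^sub>R ?Q1) + (neg_L1 (\<alpha> *\<^sub>R ?Q2) + neg_L1 ((2 * \<alpha>) *\<^sub>R ?Q3))"
    by (metis add_left_mono neg_L1_add_le order_trans)
  also have "\<dots> = \<alpha> * neg_L1 ?Q1 + (\<alpha> * neg_L1 ?Q2 + 2 * \<alpha> * neg_L1 ?Q3)"
    using alpha by (simp add: neg_L1_scaleR)
  also have "\<dots> \<le> \<alpha> * (2 * neg_L1 f) + (\<alpha> * (2 * neg_L1 f) + 2 * \<alpha> * (2 * neg_L1 f))"
    using alpha by (intro add_mono mult_left_mono neg_nonlocal_L1_shift borel_sets lebesgue_sets) auto
  finally show ?thesis by simp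
qed

lemma source_in_L1_on: "source_l f \<in> L1_on \<Omega>\<^sub>l" "source_n f \<in> L1_on \<Omega>\<^sub>n"
proof -
  have "restrict_l (source_l f) = source_l f"
    unfolding local_region_source_eq[OF borel_sets(1)]
    using nonlocal_L1_in_L1_on[OF lebesgue_sets(2) borel_sets(3)]
    by (simp add: restrict_l.scaleR in_L1_on_iff[OF lebesgue_sets(2)])
  then show "source_l f \<in> L1_on \<Omega>\<^sub>l" by (simp add: in_L1_on_iff[OF lebesgue_sets(2)])
  have "restrict_n (source_n f) = source_n f"
    unfolding nonlocal_region_rhs_eq[OF borel_sets(2)]
    using nonlocal_L1_in_L1_on[OF lebesgue_sets(3) borel_sets(4)]
      nonlocal_L1_in_L1_on[OF lebesgue_sets(3) borel_sets(2)]
    by (simp add: restrict_n.add restrict_n.scaleR in_L1_on_iff[OF lebesgue_sets(3)])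
  then show "source_n f \<in> L1_on \<Omega>\<^sub>n" by (simp add: in_L1_on_iff[OF lebesgue_sets(3)])
qed

lemma restrict_B: "restrict_l (B f) = source_l f" "restrict_n (B f) = source_n f"
proof -
  have "restrict_l (source_l f) = source_l f" "restrict_n (source_n f) = source_n f"
    using source_in_L1_on in_L1_on_iff lebesgue_sets by blast+
  moreover have "restrict_l (source_n f) = 0" "restrict_n (source_l f) = 0"
    using restrict_L1_on_disjoint source_in_L1_on lebesgue_sets sets(7) by (metis Int_commute)+
  ultimately show "restrict_l (B f) = source_l f" "restrict_n (B f) = source_n f"
    by (simp_all add: B_def restrict_l.add restrict_n.add)
qed

lemma restrict_T:
  assumes t: "t \<ge> 0"
  shows "restrict_l (T t f) = S t (restrict_l f)" "restrict_n (T t f) = restrict_n f"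
proof -
  show "restrict_l (T t f) = S t (restrict_l f)"
    by (rule restrict_extend_semigroup[OF heat lmeasurable_local t])
  have "S t (restrict_l f) \<in> L1_on \<Omega>\<^sub>l" "restrict_l f \<in> L1_on \<Omega>\<^sub>l"
    using heat_in_L1_on[OF heat lmeasurable_local t] restrict_in_L1_on[OF lebesgue_sets(2)] by auto
  then have "restrict_n (S t (restrict_l f)) = 0" "restrict_n (restrict_l f) = 0"
    using restrict_L1_on_disjoint lebesgue_sets sets(7) by (metis Int_commute)+
  then show "restrict_n (T t f) = restrict_n f"
    by (simp add: extend_semigroup_def restrict_n.add restrict_n.diff)
qed

lemma T_in_L1_on:
  assumes t: "t \<ge> 0" and f: "f \<in> L1_on \<Omega>"
  shows "T t f \<in> L1_on \<Omega>"
proof -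
  have "S t (restrict_l f) \<in> L1_on \<Omega>" "restrict_l f \<in> L1_on \<Omega>"
    using heat_in_L1_on[OF heat lmeasurable_local t] restrict_in_L1_on[OF lebesgue_sets(2)]
      L1_on_mono[OF sets(5)] by blast+
  then show ?thesis
    unfolding extend_semigroup_def by (intro L1_on_add L1_on_diff lebesgue_sets f)
qed

lemma B_in_L1_on: "B f \<in> L1_on \<Omega>"
  unfolding B_def using source_in_L1_on[of f] L1_on_mono[OF sets(5)] L1_on_mono[OF sets(6)]
  by (intro L1_on_add lebesgue_sets) auto

text \<open>This is where the null interface enters: the two equations prescribe a solution only on
  \<open>\<Omega>\<^sub>l\<close> and \<open>\<Omega>\<^sub>n\<close>, and would leave it
  undetermined on a remainder of positive measure.\<close>

lemma split_L1_on:
  assumes "f \<in> L1_on \<Omega>"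
  shows "f = restrict_l f + restrict_n f"
proof (rule L1_eqI)
  have "AE x in lebesgue. x \<notin> \<Omega> - \<Omega>\<^sub>l - \<Omega>\<^sub>n"
    unfolding AE_lebesgue_iff_negligible not_not Collect_mem_eq by (rule interface)
  moreover have "AE x in lebesgue. x \<notin> \<Omega> \<longrightarrow> rep_L1 f x = 0"
    using assms by (simp add: L1_on_def)
  ultimately show "AE x in lebesgue. rep_L1 f x = rep_L1 (restrict_l f + restrict_n f) x"
    using rep_restrict_L1[OF lebesgue_sets(2), of f] rep_restrict_L1[OF lebesgue_sets(3), of f]
      rep_plus_L1[of "restrict_l f" "restrict_n f"]
    by eventually_elim (use sets(7) in \<open>auto simp: indicator_def\<close>)
qed

text \<open>The sum of the two integral equations is the formula for \<open>T\<close>, because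
  \<open>T\<close> acts as \<open>S\<close> on the local part and as the identity on the nonlocal
  part.\<close>

lemma mild_solution_imp_mild:
  assumes u0: "u0 \<in> L1_on \<Omega>" and u: "mild_solution J \<alpha> \<Omega> \<Omega>\<^sub>l \<Omega>\<^sub>n S u0 u"
  shows "mild B u0 u"
  unfolding mild_def
proof (intro allI impI)
  fix t :: real assume t: "t \<ge> 0"
  have n: "((\<lambda>s. source_n (u s)) has_integral (restrict_n (u t) - restrict_n u0)) {0..t}"
    and l: "((\<lambda>s. S (t - s) (source_l (u s))) has_integral (restrict_l (u t) - S t (restrict_l u0))) {0..t}"
    and ut: "u t \<in> L1_on \<Omega>"
    using u t unfolding mild_solution_def by auto
  have split: "T r f = S r (restrict_l f) + restrict_n f" if "r \<ge> 0" "f \<in> L1_on \<Omega>" for r f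
    using split_L1_on[OF T_in_L1_on[OF that]] restrict_T[OF that(1)] by simp
  have "(restrict_l (u t) - S t (restrict_l u0)) + (restrict_n (u t) - restrict_n u0) = u t - T t u0"
    using split_L1_on[OF ut] split[OF t u0] by simp
  with has_integral_add[OF l n]
  have "((\<lambda>s. S (t - s) (source_l (u s)) + source_n (u s)) has_integral u t - T t u0) {0..t}" by simp
  then show "((\<lambda>s. T (t - s) (B (u s))) has_integral u t - T t u0) {0..t}"
    by (rule has_integral_eq[rotated]) (simp add: split B_in_L1_on restrict_B)
qed

lemma mild_imp_mild_solution:
  assumes u0: "u0 \<in> L1_on \<Omega>" and cont: "continuous_on {0..} u" and mild: "mild B u0 u"
  shows "mild_solution J \<alpha> \<Omega> \<Omega>\<^sub>l \<Omega>\<^sub>n S u0 u"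
  unfolding mild_solution_def
proof (intro conjI allI impI)
  note int = mild[unfolded mild_def, rule_format]
  show "u 0 = u0"
    using has_integral_unique[OF int[of 0]] has_integral_refl(2)[of _ "0 :: real"] at_0 by fastforce
  interpret \<Omega>: bounded_linear "restrict_L1 \<Omega>" by (rule bounded_linear_restrict_L1[OF lebesgue_sets(1)])
  fix t :: real assume t: "t \<ge> 0"
  \<comment> \<open>The exterior condition is not built into \<open>mild\<close>. The projection
    onto the part outside \<open>\<Omega>\<close> annihilates the integrand, and being bounded and
    linear it annihilates the integral too.\<close>
  have "bounded_linear (\<lambda>f. f - restrict_L1 \<Omega> f)"
    by (intro bounded_linear_sub bounded_linear_ident \<Omega>.bounded_linear_axioms)
  from has_integral_linear[OF int[OF t] this]
  have outside: "((\<lambda>s. T (t - s) (B (u s)) - restrict_L1 \<Omega> (T (t - s) (B (u s)))) has_integral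
      (u t - T t u0) - restrict_L1 \<Omega> (u t - T t u0)) {0..t}"
    by (simp add: o_def)
  have "T (t - s) (B (u s)) - restrict_L1 \<Omega> (T (t - s) (B (u s))) = 0" if "s \<in> {0..t}" for s
    using T_in_L1_on[OF _ B_in_L1_on, of "t - s"] that by (simp add: in_L1_on_iff[OF lebesgue_sets(1)])
  from has_integral_eq[OF this outside]
  have "((\<lambda>s. 0) has_integral (u t - T t u0) - restrict_L1 \<Omega> (u t - T t u0)) {0..t}" .
  then have "u t - T t u0 \<in> L1_on \<Omega>"
    by (simp add: in_L1_on_iff[OF lebesgue_sets(1)])
  then show "u t \<in> L1_on \<Omega>"
    using L1_on_add[OF lebesgue_sets(1) _ T_in_L1_on[OF t u0]] by fastforce
  have "((\<lambda>s. restrict_n (T (t - s) (B (u s)))) has_integral restrict_n (u t - T t u0)) {0..t}"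
    using has_integral_linear[OF int[OF t] restrict_n.bounded_linear_axioms] by (simp add: o_def)
  then have "((\<lambda>s. restrict_n (T (t - s) (B (u s)))) has_integral restrict_n (u t) - restrict_n u0) {0..t}"
    by (simp add: restrict_n.diff restrict_T[OF t])
  then show "((\<lambda>s. source_n (u s)) has_integral restrict_n (u t) - restrict_n u0) {0..t}"
    by (rule has_integral_eq[rotated]) (simp add: restrict_T restrict_B)
  have "((\<lambda>s. restrict_l (T (t - s) (B (u s)))) has_integral restrict_l (u t - T t u0)) {0..t}"
    using has_integral_linear[OF int[OF t] restrict_l.bounded_linear_axioms] by (simp add: o_def)
  then have "((\<lambda>s. restrict_l (T (t - s) (B (u s)))) has_integral restrict_l (u t) - S t (restrict_l u0)) {0..t}"
    by (simp add: restrict_l.diff restrict_T[OF t])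
  then show "((\<lambda>s. S (t - s) (source_l (u s))) has_integral restrict_l (u t) - S t (restrict_l u0)) {0..t}"
    by (rule has_integral_eq[rotated]) (simp add: restrict_T restrict_B)
qed (rule cont)

text \<open>By linearity only the difference matters, with initial value \<open>u0 - v0\<close>.
  Both initial values vanish off \<open>\<Omega>\<close>, so their order on \<open>\<Omega>\<close>
  is an order on the whole space, over which \<open>neg_L1\<close> integrates.\<close>

theorem comparison:
  assumes u0: "u0 \<in> L1_on \<Omega>" and v0: "v0 \<in> L1_on \<Omega>"
    and u: "mild_solution J \<alpha> \<Omega> \<Omega>\<^sub>l \<Omega>\<^sub>n S u0 u" and v: "mild_solution J \<alpha> \<Omega> \<Omega>\<^sub>l \<Omega>\<^sub>n S v0 v"
    and le: "AE x in lebesgue. x \<in> \<Omega> \<longrightarrow> rep_L1 v0 x \<le> rep_L1 u0 x" and t: "t \<ge> 0"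
  shows "neg_L1 (u t - v t) = 0"
proof (rule mild_nonneg[OF contraction_semigroup_axioms _ bounded_linear_B neg_B_shift _ _ _ t])
  show "neg_L1 (T t f) \<le> neg_L1 f" if "t \<ge> 0" for t f
    by (rule neg_extend_semigroup[OF heat lmeasurable_local that])
  show "continuous_on {0..} (\<lambda>t. u t - v t)"
    using u v unfolding mild_solution_def by (intro continuous_intros) auto
  show "mild B (u0 - v0) (\<lambda>t. u t - v t)"
    by (intro mild_diff bounded_linear_B mild_solution_imp_mild u0 v0 u v)
  have "AE x in lebesgue. x \<notin> \<Omega> \<longrightarrow> rep_L1 u0 x = 0" "AE x in lebesgue. x \<notin> \<Omega> \<longrightarrow> rep_L1 v0 x = 0"
    using u0 v0 by (auto simp: L1_on_def)
  with le rep_minus_L1[of u0 v0] have "AE x in lebesgue. rep_L1 (u0 - v0) x \<ge> 0"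
    by eventually_elim auto
  then show "neg_L1 (u0 - v0) = 0" by (simp add: neg_L1_eq_0_iff)
qed

theorem unique_solution:
  assumes "u0 \<in> L1_on \<Omega>"
    and "mild_solution J \<alpha> \<Omega> \<Omega>\<^sub>l \<Omega>\<^sub>n S u0 u" "mild_solution J \<alpha> \<Omega> \<Omega>\<^sub>l \<Omega>\<^sub>n S u0 v" and t: "t \<ge> 0"
  shows "v t = u t"
proof -
  have "neg_L1 (u t - v t) = 0" "neg_L1 (v t - u t) = 0"
    using comparison[OF assms(1,1,2,3) _ t] comparison[OF assms(1,1,3,2) _ t] by auto
  then have "norm (u t - v t) = 0" by (simp add: norm_eq_neg_L1[of "u t - v t"])
  then show ?thesis by simp
qed

theorem solution_exists:
  assumes "u0 \<in> L1_on \<Omega>"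
  shows "\<exists>u. mild_solution J \<alpha> \<Omega> \<Omega>\<^sub>l \<Omega>\<^sub>n S u0 u"
  using mild_exists[OF bounded_linear_B] mild_imp_mild_solution[OF assms] by blast

end

theorem theorem1p3:
  fixes J :: "real ^ 'n \<Rightarrow> real" and \<alpha> :: real
    and \<Omega> \<Omega>\<^sub>l \<Omega>\<^sub>n \<Gamma> :: "(real ^ 'n) set"
    and S :: "real \<Rightarrow> (real ^ 'n) L1 \<Rightarrow> (real ^ 'n) L1"
  assumes J: "\<And>x. J x \<ge> 0" "radial J" "has_bochner_integral lebesgue J 1"
    and alpha: "\<alpha> > 0"
    and domain: "smooth_bounded_domain \<Omega>" "divides_domain \<Gamma> \<Omega> \<Omega>\<^sub>l \<Omega>\<^sub>n"
    and semigroup: "heat_semigroup \<Omega>\<^sub>l (frontier \<Omega> \<inter> frontier \<Omega>\<^sub>l) S"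
  shows "(\<forall>u0 \<in> L1_on \<Omega>.
            \<exists>u. mild_solution J \<alpha> \<Omega> \<Omega>\<^sub>l \<Omega>\<^sub>n S u0 u \<and>
                (\<forall>v. mild_solution J \<alpha> \<Omega> \<Omega>\<^sub>l \<Omega>\<^sub>n S u0 v \<longrightarrow> (\<forall>t\<ge>0. v t = u t)))
       \<and> (\<forall>u0 \<in> L1_on \<Omega>. \<forall>v0 \<in> L1_on \<Omega>. \<forall>u v.
            mild_solution J \<alpha> \<Omega> \<Omega>\<^sub>l \<Omega>\<^sub>n S u0 u \<longrightarrow>
            mild_solution J \<alpha> \<Omega> \<Omega>\<^sub>l \<Omega>\<^sub>n S v0 v \<longrightarrow>
            (AE x in lebesgue. x \<in> \<Omega> \<longrightarrow> rep_L1 u0 x \<ge> rep_L1 v0 x) \<longrightarrow>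
            (\<forall>t\<ge>0. AE x in lebesgue. x \<in> \<Omega> \<longrightarrow> rep_L1 (u t) x \<ge> rep_L1 (v t) x))"
proof -
  interpret local_nonlocal_problem J \<alpha> \<Omega> \<Omega>\<^sub>l \<Omega>\<^sub>n "frontier \<Omega> \<inter> frontier \<Omega>\<^sub>l" S
  proof
    show "open \<Omega>" "bounded \<Omega>" using domain(1) by (auto simp: smooth_bounded_domain_def)
    have parts: "\<Omega> = \<Omega>\<^sub>l \<union> \<Gamma> \<union> \<Omega>\<^sub>n" "open \<Omega>\<^sub>l" "open \<Omega>\<^sub>n" "\<Omega>\<^sub>l \<inter> \<Omega>\<^sub>n = {}"
      using domain(2) by (simp_all only: divides_domain_def)
    then show "open \<Omega>\<^sub>l" "open \<Omega>\<^sub>n" "\<Omega>\<^sub>l \<subseteq> \<Omega>" "\<Omega>\<^sub>n \<subseteq> \<Omega>" "\<Omega>\<^sub>l \<inter> \<Omega>\<^sub>n = {}" by auto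
    show "negligible (\<Omega> - \<Omega>\<^sub>l - \<Omega>\<^sub>n)"
      by (rule negligible_subset[OF divides_domain_negligible[OF domain(2)]]) (use parts(1) in auto)
  qed (use J alpha semigroup in auto)
  show ?thesis
  proof (intro conjI ballI allI impI)
    fix u0 :: "(real ^ 'n) L1" assume u0: "u0 \<in> L1_on \<Omega>"
    obtain u where u: "mild_solution J \<alpha> \<Omega> \<Omega>\<^sub>l \<Omega>\<^sub>n S u0 u" using solution_exists[OF u0] ..
    show "\<exists>u. mild_solution J \<alpha> \<Omega> \<Omega>\<^sub>l \<Omega>\<^sub>n S u0 u \<and>
        (\<forall>v. mild_solution J \<alpha> \<Omega> \<Omega>\<^sub>l \<Omega>\<^sub>n S u0 v \<longrightarrow> (\<forall>t\<ge>0. v t = u t))"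
      by (intro exI[of _ u] conjI allI impI u) (rule unique_solution[OF u0 u])
  next
    fix u0 v0 :: "(real ^ 'n) L1" and u v :: "real \<Rightarrow> (real ^ 'n) L1" and t :: real
    assume "u0 \<in> L1_on \<Omega>" "v0 \<in> L1_on \<Omega>" "mild_solution J \<alpha> \<Omega> \<Omega>\<^sub>l \<Omega>\<^sub>n S u0 u"
      "mild_solution J \<alpha> \<Omega> \<Omega>\<^sub>l \<Omega>\<^sub>n S v0 v"
      "AE x in lebesgue. x \<in> \<Omega> \<longrightarrow> rep_L1 u0 x \<ge> rep_L1 v0 x" "t \<ge> 0"
    from comparison[OF this, unfolded neg_L1_eq_0_iff] rep_minus_L1[of "u t" "v t"]
    show "AE x in lebesgue. x \<in> \<Omega> \<longrightarrow> rep_L1 (u t) x \<ge> rep_L1 (v t) x"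
      by eventually_elim simp
  qed
qed

end
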